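(* Let $A,B,C_1,\dots,C_p,D_1,\dots,D_q\in\mathbb{C}^{N\times N}$ be such that each $D_j+kI$, $1\le j\le q$, is invertible for all integers $k\ge 0$, and let $r\ge 1$ be an integer. Then ${}_pR_q(A,B;z)$ satisfies the following matrix differential formulas. (i) If $C_lC_m=C_mC_l$, $C_lA=AC_l$, $C_lB=BC_l$ for all $1\le l,m\le p$ and $D_iD_j=D_jD_i$ for all $1\le i,j\le q$, then $$\left(\frac{d}{dz}\right)^r{}_pR_q(A,B;z)=(C_1)_r\cdots(C_p)_r\;{}_pR_q\left(\begin{array}{c}C_1+rI,\dots,C_p+rI\\ D_1+rI,\dots,D_q+rI\end{array}\mid A,rA+B;z\right)(D_1)_r^{-1}\cdots(D_q)_r^{-1}.$$ (ii) For $1\le j\le q$, if $D_iD_j=D_jD_i$ for all $1\le i\le q$, then $$\left(\frac{d}{dz}\right)^r\left({}_pR_q(A,B;z)\,z^{D_j-I}\right)={}_pR_q\left(\begin{array}{c}C_1,\dots,C_p\\ D_1,\dots,D_{j-1},D_j-rI,D_{j+1},\dots,D_q\end{array}\mid A,B;z\right)(-1)^r z^{D_j-(r+1)I}\,(I-D_j)_r.$$ (iii) If $C_iC_j=C_jC_i$, $C_iA=AC_i$, $C_iB=BC_i$ for all $1\le i,j\le p$, then for each $1\le i\le p$ $$\left(z^2\frac{d}{dz}\right)^r\left(z^{C_i-(r-1)I}\,{}_pR_q(A,B;z)\right)=(C_i)_r\,z^{C_i+rI}\,{}_pR_q\left(\begin{array}{c}C_1,\dots,C_{i-1},C_i+rI,C_{i+1},\dots,C_p\\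 D_1,\dots,D_q\end{array}\mid A,B;z\right).$$
   Context: The Pochhammer symbol of a square matrix $M$ is $(M)_0=I$, $(M)_n=M(M+I)\cdots(M+(n-1)I)$ for $n\ge 1$. $\Gamma^{-1}(M)$ denotes the entire function $1/\Gamma$ applied to $M$, and $z^M=\exp(M\log z)$. For matrices $A,B,C_1,\dots,C_p,D_1,\dots,D_q$ such that each $D_j+kI$ is invertible for all integers $k\ge 0$, one defines $${}_pR_q(A,B;z)={}_pR_q\left(\begin{array}{c}C_1,\dots,C_p\\ D_1,\dots,D_q\end{array}\mid A,B;z\right)=\sum_{n\ge 0}\Gamma^{-1}(nA+B)\,(C_1)_n\cdots(C_p)_n\,(D_1)_n^{-1}\cdots(D_q)_n^{-1}\,\frac{z^n}{n!},$$ with products taken in the written order. The invertibility condition in this definition is assumed for the parameters of every function ${}_pR_q$ appearing (in particular for $D_j-rI$ in (ii)).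
   Formalization: In (iii) the differentiated function is z^{C_i} pRq instead of z^{C_i-(r-1)I} pRq; the printed form fails for r=2, p=1, q=0, A=0, B=I, C_1=-I (left side 2I, right side 0), and both forms agree for r=1. *)

theory Defs
  imports "HOL-Analysis.Analysis"
begin

text \<open>
  Square complex matrices of size N are elements of \<open>complex^'n^'n\<close> with \<open>N = CARD('n)\<close>.
  The matrix product is \<open>**\<close>; the type-class operations \<open>*\<close>, \<open>^\<close> and \<open>1\<close> on this type are
  entrywise and are not used here. The scalar matrix \<open>c I\<close> is \<open>mat c\<close>, so that multiplying
  \<open>M\<close> by the scalar \<open>c\<close> is \<open>mat c ** M\<close>.
\<close>

definition mat_prod :: "(complex^'n^'n) list \<Rightarrow> complex^'n^'n" where
  "mat_prod Ms = foldr (**) Ms (mat 1)"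

definition mat_power :: "complex^'n^'n \<Rightarrow> nat \<Rightarrow> complex^'n^'n" where
  "mat_power M k = (((**) M) ^^ k) (mat 1)"

definition mat_pochhammer :: "complex^'n^'n \<Rightarrow> nat \<Rightarrow> complex^'n^'n" where
  "mat_pochhammer M n = mat_prod (map (\<lambda>k. M + mat (of_nat k)) [0..<n])"

text \<open>
  The value of an entire function \<open>f\<close> at a matrix, through the Taylor series of \<open>f\<close> at 0.
  It is only meaningful for entire \<open>f\<close>; it is used below for \<open>rGamma\<close> (that is, \<open>1/\<Gamma>\<close>)
  and \<open>exp\<close>.
\<close>

definition entire_mat :: "(complex \<Rightarrow> complex) \<Rightarrow> complex^'n^'n \<Rightarrow> complex^'n^'n" where
  "entire_mat f M = (\<Sum>k. mat ((deriv ^^ k) f 0 / fact k) ** mat_power M k)"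

text \<open>\<open>Ln\<close> is the principal branch, so \<open>z powm M\<close> is holomorphic in \<open>z\<close> off the half-line
  \<open>\<real>\<^sub>\<le>\<^sub>0\<close>.\<close>

definition mat_powr :: "complex \<Rightarrow> complex^'n^'n \<Rightarrow> complex^'n^'n"  (infixr \<open>powm\<close> 80) where
  "z powm M = entire_mat exp (M ** mat (Ln z))"

text \<open>The parameters \<open>C\<^sub>1, \<dots>, C\<^sub>p\<close> and \<open>D\<^sub>1, \<dots>, D\<^sub>q\<close> are lists (possibly empty), indexed from 0.\<close>

definition admissible :: "(complex^'n^'n) list \<Rightarrow> bool" where
  "admissible Ds \<longleftrightarrow> (\<forall>D\<in>set Ds. \<forall>k::nat. invertible (D + mat (of_nat k)))"

definition pRq_coeff ::
  "(complex^'n^'n) list \<Rightarrow> (complex^'n^'n) list \<Rightarrow> complex^'n^'n \<Rightarrow> complex^'n^'n \<Rightarrow> nat \<Rightarrow> complex^'n^'n"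
where
  "pRq_coeff Cs Ds A B n =
     mat (1 / fact n) **
     (entire_mat rGamma (mat (of_nat n) ** A + B) **
      mat_prod (map (\<lambda>C. mat_pochhammer C n) Cs) **
      mat_prod (map (\<lambda>D. matrix_inv (mat_pochhammer D n)) Ds))"

definition pRq ::
  "(complex^'n^'n) list \<Rightarrow> (complex^'n^'n) list \<Rightarrow> complex^'n^'n \<Rightarrow> complex^'n^'n \<Rightarrow> complex \<Rightarrow> complex^'n^'n"
where
  "pRq Cs Ds A B z = (\<Sum>n. mat (z ^ n) ** pRq_coeff Cs Ds A B n)"

text \<open>The open disc of convergence of the power series \<open>pRq\<close> (all of \<open>\<complex>\<close> if the radius is
  infinite, empty if it is 0). Replacing \<open>C\<close> by \<open>C + r I\<close> can shrink this disc when \<open>(C)\<^sub>r\<close> is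
  singular: \<open>C = 0\<close> gives a constant series, but \<open>C = r I\<close> in general does not.\<close>

definition pRq_disc ::
  "(complex^'n^'n) list \<Rightarrow> (complex^'n^'n) list \<Rightarrow> complex^'n^'n \<Rightarrow> complex^'n^'n \<Rightarrow> complex set"
where
  "pRq_disc Cs Ds A B = eball 0 (conv_radius (pRq_coeff Cs Ds A B))"

definition mat_holomorphic_on :: "(complex \<Rightarrow> complex^'n^'n) \<Rightarrow> complex set \<Rightarrow> bool" where
  "mat_holomorphic_on F S \<longleftrightarrow> (\<forall>i j. (\<lambda>z. F z $ i $ j) holomorphic_on S)"

definition mat_deriv :: "(complex \<Rightarrow> complex^'n^'n) \<Rightarrow> complex \<Rightarrow> complex^'n^'n" where
  "mat_deriv F z = (\<chi> i j. deriv (\<lambda>w. F w $ i $ j) z)"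

text \<open>The operator \<open>z\<^sup>2 d/dz\<close>.\<close>

definition z2_deriv :: "(complex \<Rightarrow> complex^'n^'n) \<Rightarrow> complex \<Rightarrow> complex^'n^'n" where
  "z2_deriv F z = mat (z ^ 2) ** mat_deriv F z"

end

theory Submission
  imports Defs "HOL-Complex_Analysis.Cauchy_Integral_Formula"
begin

text \<open>The obstacle is the order of the factors. In a coefficient, Gamma^{-1}(nA+B) and the
  products of the C's stand to the left of the inverse products of the D's, and no commutation
  between C's and D's is assumed. A factor made from D's can therefore leave a coefficient only to
  the right, and one made from C's only to the left, past Gamma^{-1}(nA+B); this is why the C's have
  to commute with A and B. It also fixes the side of the powers: z^(D_j-I) multiplies from the
  right, z^(C_i) from the left.

  The discs behave differently in the three formulas. In (i) and (iii) the shifted coefficients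
  appear behind a factor (C)_r that may be singular, so their convergence cannot be read off from
  the original series and both discs are intersected. In (ii) the factor is (D_j-rI)_r, which is
  invertible because the lowered list is admissible, and the original disc suffices.\<close>

text \<open>
  Entry by entry, \<open>pRq\<close> is a scalar power series, so all derivatives may be taken termwise.
  Pochhammer factors of parameters that commute with the rest can be moved through the
  coefficients, and each formula then becomes \<open>(M)\<^bsub>m+n\<^esub> = (M)\<^sub>m (M + mI)\<^sub>n\<close>, read for the
  parameter that is shifted. The derivative formulas in (ii) and (iii) are proved first with an
  arbitrary coefficient sequence \<open>a\<close>, on the disc of \<open>a\<close>, so that the intermediate series
  need no comparison of their radii of convergence.

  The law \<open>z\<^bsup>M+cI\<^esup> = z\<^sup>c z\<^sup>M\<close> holds because the derivative of
  \<open>e\<^bsup>-ct\<^esup> exp(-tM) exp(t(M + cI))\<close> vanishes.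
\<close>

section \<open>Commuting matrices and Pochhammer symbols\<close>

lemma mat_mult_nth [simp]:
  fixes X :: "'a::comm_ring_1^'n^'n"
  shows "(mat c ** X) $ i $ j = c * X $ i $ j"
  by (simp add: matrix_matrix_mult_def mat_def if_distrib if_distribR sum.delta' cong: if_cong)

lemma mult_mat_commute:
  fixes X :: "'a::comm_ring_1^'n^'n"
  shows "X ** mat c = mat c ** X"
  by (simp add: vec_eq_iff)
    (simp add: matrix_matrix_mult_def mat_def if_distrib if_distribR sum.delta mult.commute cong: if_cong)

lemma mat_mult_mat: "mat a ** mat b = (mat (a * b) :: 'a::comm_ring_1^'n^'n)"
  by (simp add: vec_eq_iff) (simp add: mat_def)

lemma mat_mult_mat_left: "mat a ** (mat b ** X) = mat (a * b) ** (X :: 'a::comm_ring_1^'n^'n)"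
  by (simp add: matrix_mul_assoc mat_mult_mat)

lemma mat_add_mat: "mat a + mat b = (mat (a + b) :: 'a::comm_ring_1^'n^'n)"
  by (simp add: vec_eq_iff mat_def)

lemma matrix_add_rdistrib': "(X + Y) ** Z = X ** Z + Y ** (Z :: 'a::comm_ring_1^'n^'n)"
  by (simp add: vec_eq_iff matrix_matrix_mult_def distrib_right sum.distrib)

lemma matrix_uminus_left: "(- X) ** Y = - (X ** (Y :: 'a::comm_ring_1^'n^'n))"
  by (simp add: vec_eq_iff matrix_matrix_mult_def sum_negf)

lemma matrix_uminus_right: "X ** (- Y) = - (X ** (Y :: 'a::comm_ring_1^'n^'n))"
  by (simp add: vec_eq_iff matrix_matrix_mult_def sum_negf)

lemma matrix_scaleR_left: "(c *\<^sub>R X) ** Y = c *\<^sub>R (X ** (Y :: complex^'n^'n))"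
  by (simp add: vec_eq_iff matrix_matrix_mult_def scaleR_sum_right)

lemma matrix_scaleR_right: "X ** (c *\<^sub>R Y) = c *\<^sub>R (X ** (Y :: complex^'n^'n))"
  by (simp add: vec_eq_iff matrix_matrix_mult_def scaleR_sum_right)

lemma bounded_linear_mult_left: "bounded_linear (\<lambda>Y :: complex^'n^'n. (X :: complex^'n^'n) ** Y)"
  by (simp add: linear_conv_bounded_linear[symmetric] linearI matrix_add_ldistrib matrix_scaleR_right)

lemma bounded_linear_mult_right: "bounded_linear (\<lambda>Y :: complex^'n^'n. Y ** (X :: complex^'n^'n))"
  unfolding linear_conv_bounded_linear[symmetric]
  by (rule linearI) (simp_all add: matrix_add_rdistrib' matrix_scaleR_left)

section \<open>Commutation as a relation, with closure rules that can be chained by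
  \<open>intro\<close>\<close>

definition mcommute :: "complex^'n^'n \<Rightarrow> complex^'n^'n \<Rightarrow> bool" where
  "mcommute X Y \<longleftrightarrow> X ** Y = Y ** X"

lemma mcommuteD: "mcommute X Y \<Longrightarrow> X ** Y = Y ** X"
  by (simp add: mcommute_def)

lemma mcommute_sym: "mcommute X Y \<Longrightarrow> mcommute Y X"
  by (simp add: mcommute_def)

lemma mcommute_refl [simp]: "mcommute X X"
  by (simp add: mcommute_def)

lemma mcommute_mat [simp]: "mcommute X (mat c)" "mcommute (mat c) X"
  by (simp_all add: mcommute_def mult_mat_commute)

lemma mcommute_mult: "mcommute X Y \<Longrightarrow> mcommute X Z \<Longrightarrow> mcommute X (Y ** Z)"
  unfolding mcommute_def by (metis (no_types) matrix_mul_assoc)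

lemma mcommute_add: "mcommute X Y \<Longrightarrow> mcommute X Z \<Longrightarrow> mcommute X (Y + Z)"
  by (simp add: mcommute_def matrix_add_ldistrib matrix_add_rdistrib')

lemma mcommute_uminus: "mcommute X Y \<Longrightarrow> mcommute X (- Y)"
  by (simp add: mcommute_def matrix_uminus_left matrix_uminus_right)

lemma mcommute_shift: "mcommute (X + mat a) (X + mat b)"
proof -
  have "mcommute X (X + mat b)" by (simp add: mcommute_add)
  then show ?thesis
    by (intro mcommute_sym[OF mcommute_add[OF mcommute_sym mcommute_mat(1)]])
qed

lemma diff_mat: "X - mat c = X + mat (- c :: 'a::comm_ring_1)"
  by (simp add: vec_eq_iff mat_def)

lemma mcommute_diff_mat: "mcommute X Y \<Longrightarrow> mcommute X (Y - mat c)"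
  by (simp add: diff_mat mcommute_add)

section \<open>Ordered products of matrices\<close>

lemma mat_prod_Nil [simp]: "mat_prod [] = mat 1"
  and mat_prod_Cons [simp]: "mat_prod (X # Xs) = X ** mat_prod Xs"
  by (simp_all add: mat_prod_def)

lemma mat_prod_append: "mat_prod (Xs @ Ys) = mat_prod Xs ** mat_prod Ys"
  by (induction Xs) (simp_all add: matrix_mul_assoc)

lemma mcommute_mat_prod: "(\<And>Y. Y \<in> set Ys \<Longrightarrow> mcommute X Y) \<Longrightarrow> mcommute X (mat_prod Ys)"
  by (induction Ys) (simp_all add: mcommute_mult)

text \<open>Each \<open>g x\<close> moves to the right past the factors \<open>f y\<close> that
  follow it. The \<open>f\<close>'s keep their order among themselves, and so do the
  \<open>g\<close>'s.\<close>

lemma mat_prod_map_mult: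
  assumes "\<And>x y. x \<in> set xs \<Longrightarrow> y \<in> set xs \<Longrightarrow> mcommute (f x) (g y)"
  shows "mat_prod (map (\<lambda>x. f x ** g x) xs) = mat_prod (map f xs) ** mat_prod (map g xs)"
  using assms
proof (induction xs)
  case (Cons x xs)
  have "mcommute (g x) (mat_prod (map f xs))"
    using Cons.prems by (intro mcommute_mat_prod) (auto intro: mcommute_sym)
  then have "f x ** (g x ** mat_prod (map f xs)) ** mat_prod (map g xs) =
      f x ** (mat_prod (map f xs) ** g x) ** mat_prod (map g xs)"
    by (simp add: mcommute_def)
  then show ?case
    using Cons by (simp add: matrix_mul_assoc)
qed simp

text \<open>\<open>X\<close>, attached to the entry at position \<open>k\<close>, passes all later
  entries and reaches the right end. This compares two products that differ in a single
  parameter.\<close>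

lemma mat_prod_update_mult:
  assumes "k < length Ys" "\<And>Y. Y \<in> set Ys \<Longrightarrow> mcommute X Y"
  shows "mat_prod (Ys[k := Ys ! k ** X]) = mat_prod Ys ** X"
proof -
  have "mcommute X (mat_prod (drop (Suc k) Ys))"
    using assms(2) by (intro mcommute_mat_prod) (auto dest: in_set_dropD)
  then have "mat_prod (take k Ys @ (Ys ! k ** X) # drop (Suc k) Ys) =
      mat_prod (take k Ys @ Ys ! k # drop (Suc k) Ys) ** X"
    by (simp add: mat_prod_append mcommute_def flip: matrix_mul_assoc)
  then show ?thesis
    using assms(1) by (simp add: upd_conv_take_nth_drop id_take_nth_drop[symmetric])
qed

section \<open>Pochhammer symbols and inverses of matrices\<close>

lemma mat_pochhammer_0 [simp]: "mat_pochhammer X 0 = mat 1"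
  by (simp add: mat_pochhammer_def)

lemma mat_pochhammer_Suc: "mat_pochhammer X (Suc k) = mat_pochhammer X k ** (X + mat (of_nat k))"
  by (simp add: mat_pochhammer_def mat_prod_append)

lemma mat_pochhammer_add:
  "mat_pochhammer X (m + n) = mat_pochhammer X m ** mat_pochhammer (X + mat (of_nat m)) n"
  by (induction n) (simp_all add: mat_pochhammer_Suc matrix_mul_assoc add.assoc mat_add_mat)

lemma mat_pochhammer_Suc_left:
  "mat_pochhammer X (Suc k) = X ** mat_pochhammer (X + mat 1) k"
  using mat_pochhammer_add[of X 1 k] by (simp add: mat_pochhammer_Suc)

lemma mcommute_pochhammer: "mcommute X Y \<Longrightarrow> mcommute X (mat_pochhammer Y k)"
  by (induction k) (simp_all add: mat_pochhammer_Suc mcommute_mult mcommute_add)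

text \<open>For square matrices a right inverse is also a left inverse, so \<open>Y\<close> is a
  witness for the choice operator in \<open>matrix_inv\<close>; two-sided inverses are
  unique.\<close>

lemma matrix_inv_unique:
  fixes X :: "complex^'n^'n"
  assumes "X ** Y = mat 1"
  shows "matrix_inv X = Y"
proof -
  have "Y ** X = mat 1"
    using assms matrix_left_right_inverse by blast
  with assms have "X ** matrix_inv X = mat 1 \<and> matrix_inv X ** X = mat 1"
    unfolding matrix_inv_def
    by (rule_tac someI[of "\<lambda>Y. X ** Y = mat 1 \<and> Y ** X = mat 1" Y]) simp
  then have "Y ** (X ** matrix_inv X) = Y"
    by simp
  then show ?thesis
    by (simp add: matrix_mul_assoc \<open>Y ** X = mat 1\<close>)
qed

lemma matrix_inv_inverts:
  fixes X :: "complex^'n^'n"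
  assumes "invertible X"
  shows "X ** matrix_inv X = mat 1" "matrix_inv X ** X = mat 1"
proof -
  obtain Y where Y: "X ** Y = mat 1" "Y ** X = mat 1"
    using assms unfolding invertible_def by blast
  then have "matrix_inv X = Y" by (intro matrix_inv_unique)
  with Y show "X ** matrix_inv X = mat 1" "matrix_inv X ** X = mat 1" by simp_all
qed

lemma matrix_inv_mult:
  fixes X Y :: "complex^'n^'n"
  assumes "invertible X" "invertible Y"
  shows "matrix_inv (X ** Y) = matrix_inv Y ** matrix_inv X"
proof (rule matrix_inv_unique)
  have "X ** Y ** (matrix_inv Y ** matrix_inv X) = X ** (Y ** matrix_inv Y) ** matrix_inv X"
    by (simp add: matrix_mul_assoc)
  then show "X ** Y ** (matrix_inv Y ** matrix_inv X) = mat 1"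
    by (simp add: matrix_inv_inverts assms)
qed

lemma mcommute_matrix_inv:
  assumes "mcommute X Y" "invertible Y"
  shows "mcommute X (matrix_inv Y)"
proof -
  let ?Z = "matrix_inv Y"
  have "X ** ?Z = ?Z ** (Y ** X) ** ?Z"
    by (simp add: matrix_mul_assoc matrix_inv_inverts assms)
  also have "Y ** X = X ** Y"
    using assms(1) by (simp add: mcommute_def)
  also have "?Z ** (X ** Y) ** ?Z = ?Z ** X ** (Y ** ?Z)"
    by (simp add: matrix_mul_assoc)
  finally show ?thesis
    by (simp add: matrix_inv_inverts assms mcommute_def)
qed

lemma invertible_mat_pochhammer:
  assumes "\<And>k. invertible (X + mat (of_nat k))"
  shows "invertible (mat_pochhammer X n)"
proof (induction n)
  case 0
  then show ?case by (auto simp: invertible_def)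
qed (simp add: mat_pochhammer_Suc invertible_mult assms)

section \<open>Matrix power series and entrywise differentiation\<close>

definition mseries :: "(nat \<Rightarrow> complex^'n^'n) \<Rightarrow> complex \<Rightarrow> complex^'n^'n" where
  "mseries a z = (\<Sum>n. mat (z ^ n) ** a n)"

text \<open>\<open>R\<close> is only a lower bound for the radius of convergence. The series derived
  from \<open>a\<close> thus inherit the same \<open>R\<close>, whatever their exact radii
  are.\<close>

definition mseries_conv :: "ereal \<Rightarrow> (nat \<Rightarrow> complex^'n^'n) \<Rightarrow> bool" where
  "mseries_conv R a \<longleftrightarrow> (\<forall>z. ereal (norm z) < R \<longrightarrow> summable (\<lambda>n. mat (z ^ n) ** a n))"

lemma mseries_convD: "mseries_conv R a \<Longrightarrow> ereal (norm z) < R \<Longrightarrow> summable (\<lambda>n. mat (z ^ n) ** a n)"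
  by (simp add: mseries_conv_def)

lemma sums_vec_iff:
  fixes f :: "nat \<Rightarrow> 'a::real_normed_vector^'n"
  shows "f sums s \<longleftrightarrow> (\<forall>i. (\<lambda>n. f n $ i) sums (s $ i))"
proof
  assume "f sums s"
  then show "\<forall>i. (\<lambda>n. f n $ i) sums (s $ i)"
    unfolding sums_def sum_component[symmetric] by (auto intro: tendsto_vec_nth simp del: sum_component)
next
  assume "\<forall>i. (\<lambda>n. f n $ i) sums (s $ i)"
  then show "f sums s"
    unfolding sums_def sum_component[symmetric] by (blast intro: vec_tendstoI)
qed

lemma summable_vec_iff:
  fixes f :: "nat \<Rightarrow> 'a::real_normed_vector^'n"
  shows "summable f \<longleftrightarrow> (\<forall>i. summable (\<lambda>n. f n $ i))"
proof
  assume "\<forall>i. summable (\<lambda>n. f n $ i)"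
  then have "f sums (\<chi> i. \<Sum>n. f n $ i)"
    by (simp add: sums_vec_iff summable_sums)
  then show "summable f" by (rule sums_summable)
next
  assume "summable f"
  then obtain s where "f sums s" by (auto simp: summable_def)
  then show "\<forall>i. summable (\<lambda>n. f n $ i)"
    unfolding sums_vec_iff summable_def by blast
qed

text \<open>Convergence of a matrix series is convergence of its finitely many entries; this opens
  the way to the scalar theory of power series.\<close>

lemma mseries_conv_iff: "mseries_conv R a \<longleftrightarrow> (\<forall>i j. R \<le> conv_radius (\<lambda>n. a n $ i $ j))"
proof -
  have "R \<le> conv_radius (\<lambda>n. a n $ i $ j) \<longleftrightarrow>
      (\<forall>z. ereal (norm z) < R \<longrightarrow> summable (\<lambda>n. (mat (z ^ n) ** a n) $ i $ j))" for i j
  proof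
    assume "R \<le> conv_radius (\<lambda>n. a n $ i $ j)"
    then show "\<forall>z. ereal (norm z) < R \<longrightarrow> summable (\<lambda>n. (mat (z ^ n) ** a n) $ i $ j)"
      using summable_in_conv_radius[of _ "\<lambda>n. a n $ i $ j"] order_less_le_trans
      by (fastforce simp: mult.commute)
  next
    assume "\<forall>z. ereal (norm z) < R \<longrightarrow> summable (\<lambda>n. (mat (z ^ n) ** a n) $ i $ j)"
    then show "R \<le> conv_radius (\<lambda>n. a n $ i $ j)"
      by (intro conv_radius_geI_ex') (simp add: mult.commute)
  qed
  then show ?thesis
    by (auto simp: mseries_conv_def summable_vec_iff simp del: mat_mult_nth)
qed

lemma mseries_nth:
  assumes "summable (\<lambda>n. mat (z ^ n) ** a n)"
  shows "mseries a z $ i $ j = (\<Sum>n. a n $ i $ j * z ^ n)"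
proof -
  have "(\<lambda>n. (mat (z ^ n) ** a n) $ i $ j) sums (mseries a z $ i $ j)"
    using summable_sums[OF assms] unfolding mseries_def by (simp add: sums_vec_iff)
  then show ?thesis
    by (simp add: sums_iff mult.commute)
qed

text \<open>The disc in the theorem is defined through the norms of the matrix coefficients, and
  these dominate the norms of the entries.\<close>

lemma mseries_conv_le_conv_radius: "mseries_conv (conv_radius a) a"
  unfolding mseries_conv_iff
proof (intro allI)
  fix i j
  have *: "norm (a n $ i $ j) \<le> norm (a n)" for n
    by (meson Finite_Cartesian_Product.norm_nth_le order_trans)
  show "conv_radius a \<le> conv_radius (\<lambda>n. a n $ i $ j)"
  proof (rule conv_radius_geI_ex')
    fix x :: real
    assume "0 < x" "ereal x < conv_radius a"
    then have "summable (\<lambda>n. norm (a n) * x ^ n)"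
      using summable_in_conv_radius[of x "\<lambda>n. norm (a n)"] by simp
    then show "summable (\<lambda>n. a n $ i $ j * of_real x ^ n)"
      by (rule summable_comparison_test'[where N = 0])
        (use \<open>0 < x\<close> * in \<open>simp add: norm_mult norm_power mult_right_mono\<close>)
  qed
qed

lemma mseries_conv_add:
  "mseries_conv R a \<Longrightarrow> mseries_conv R b \<Longrightarrow> mseries_conv R (\<lambda>n. a n + b n)"
  by (simp add: mseries_conv_def matrix_add_ldistrib summable_add)

lemma mseries_add:
  assumes "summable (\<lambda>n. mat (z ^ n) ** a n)" "summable (\<lambda>n. mat (z ^ n) ** b n)"
  shows "mseries (\<lambda>n. a n + b n) z = mseries a z + mseries b z"
  using suminf_add[OF assms] by (simp add: mseries_def matrix_add_ldistrib)

lemma mat_left_commute: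
  fixes X Y :: "complex^'n^'n"
  shows "mat c ** (X ** Y) = X ** (mat c ** Y)"
  by (simp add: matrix_mul_assoc mult_mat_commute[of X])

lemma mseries_mult_left:
  assumes "summable (\<lambda>n. mat (z ^ n) ** a n)"
  shows "summable (\<lambda>n. mat (z ^ n) ** (X ** a n))"
    and "mseries (\<lambda>n. X ** a n) z = X ** mseries a z"
  using bounded_linear.summable[OF bounded_linear_mult_left assms, of X]
    bounded_linear.suminf[OF bounded_linear_mult_left assms, of X]
  by (simp_all add: mseries_def mat_left_commute)

lemma mseries_mult_right:
  assumes "summable (\<lambda>n. mat (z ^ n) ** a n)"
  shows "summable (\<lambda>n. mat (z ^ n) ** (a n ** X))"
    and "mseries (\<lambda>n. a n ** X) z = mseries a z ** X"
  using bounded_linear.summable[OF bounded_linear_mult_right assms, of X]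
    bounded_linear.suminf[OF bounded_linear_mult_right assms, of X]
  by (simp_all add: mseries_def matrix_mul_assoc)

lemma mseries_conv_mult_left: "mseries_conv R a \<Longrightarrow> mseries_conv R (\<lambda>n. X ** a n)"
  by (simp add: mseries_conv_def mseries_mult_left)

lemma mseries_conv_mult_right: "mseries_conv R a \<Longrightarrow> mseries_conv R (\<lambda>n. a n ** X)"
  by (simp add: mseries_conv_def mseries_mult_right)

lemma mcommute_mseries:
  assumes "summable (\<lambda>n. mat (z ^ n) ** a n)" "\<And>n. mcommute X (a n)"
  shows "mcommute X (mseries a z)"
proof -
  have "X ** mseries a z = mseries (\<lambda>n. X ** a n) z"
    using mseries_mult_left[OF assms(1)] by simp
  also have "\<dots> = mseries (\<lambda>n. a n ** X) z"
    using assms(2) by (simp add: mcommute_def)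
  finally show ?thesis
    using mseries_mult_right[OF assms(1)] by (simp add: mcommute_def)
qed

text \<open>\<open>mat_deriv\<close> is built on the total function \<open>deriv\<close> and says
  nothing about differentiability; this relation includes it, and so also yields holomorphy.\<close>

definition mderiv :: "(complex \<Rightarrow> complex^'n^'n) \<Rightarrow> complex^'n^'n \<Rightarrow> complex \<Rightarrow> bool" where
  "mderiv F F' z \<longleftrightarrow> (\<forall>i j. ((\<lambda>w. F w $ i $ j) has_field_derivative F' $ i $ j) (at z))"

lemma mderiv_mult:
  assumes "mderiv F F' z" "mderiv G G' z"
  shows "mderiv (\<lambda>w. F w ** G w) (F' ** G z + F z ** G') z"
  using assms unfolding mderiv_def matrix_matrix_mult_def
  by (auto intro!: derivative_eq_intros simp: sum.distrib[symmetric] algebra_simps)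

lemma mderiv_mat: "(f has_field_derivative f') (at z) \<Longrightarrow> mderiv (\<lambda>w. mat (f w)) (mat f') z"
  by (simp add: mderiv_def mat_def)

lemma mderiv_chain:
  assumes "mderiv F F' (g z)" "(g has_field_derivative g') (at z)"
  shows "mderiv (\<lambda>w. F (g w)) (mat g' ** F') z"
  using assms DERIV_chain2[of _ _ g z] by (fastforce simp: mderiv_def mult.commute)

lemma mderiv_transform:
  assumes "mderiv F F' z" "open S" "z \<in> S" "\<And>w. w \<in> S \<Longrightarrow> F w = G w"
  shows "mderiv G F' z"
  using assms has_field_derivative_transform_within_open[of _ _ z S] by (fastforce simp: mderiv_def)

lemma mderiv_imp_mat_deriv: "mderiv F F' z \<Longrightarrow> mat_deriv F z = F'"
  by (simp add: mderiv_def mat_deriv_def vec_eq_iff DERIV_imp_deriv)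

lemma mderiv_imp_holomorphic:
  assumes "\<And>z. z \<in> S \<Longrightarrow> mderiv F (F' z) z"
  shows "mat_holomorphic_on F S"
  using assms unfolding mat_holomorphic_on_def holomorphic_on_def mderiv_def
  by (meson DERIV_subset field_differentiable_def field_differentiable_at_within)

text \<open>The induction hypothesis identifies the iterate with \<open>G k\<close> only on
  \<open>S\<close>. As \<open>S\<close> is open, this already determines the derivative at every
  point of \<open>S\<close>.\<close>

lemma mat_deriv_iterate:
  assumes "open S" "\<And>k z. z \<in> S \<Longrightarrow> mderiv (G k) (G (Suc k) z) z" "z \<in> S"
  shows "(mat_deriv ^^ k) (G 0) z = G k z"
  using assms(3)
proof (induction k arbitrary: z)
  case (Suc k)
  have "mderiv ((mat_deriv ^^ k) (G 0)) (G (Suc k) z) z"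
    by (rule mderiv_transform[OF assms(2)]) (use Suc assms(1) in auto)
  then show ?case by (simp add: mderiv_imp_mat_deriv)
qed simp

lemma z2_deriv_iterate:
  assumes "open S" "\<And>k z. z \<in> S \<Longrightarrow> mderiv (G k) (G' k z) z"
    and "\<And>k z. z \<in> S \<Longrightarrow> mat (z ^ 2) ** G' k z = G (Suc k) z" "z \<in> S"
  shows "(z2_deriv ^^ k) (G 0) z = G k z"
  using assms(4)
proof (induction k arbitrary: z)
  case (Suc k)
  have "mderiv ((z2_deriv ^^ k) (G 0)) (G' k z) z"
    by (rule mderiv_transform[OF assms(2)]) (use Suc assms(1) in auto)
  then show ?case using assms(3)[OF Suc.prems]
    by (simp add: z2_deriv_def[of "(z2_deriv ^^ k) (G 0)"] mderiv_imp_mat_deriv)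
qed simp

section \<open>Termwise differentiation of matrix power series\<close>

lemma mseries_conv_diffs:
  assumes "mseries_conv R a"
  shows "mseries_conv R (\<lambda>n. mat (of_nat (Suc n)) ** a (Suc n))"
  unfolding mseries_conv_iff
proof (intro allI)
  fix i j
  let ?f = "Abs_fps (\<lambda>n. a n $ i $ j)"
  have "R \<le> fps_conv_radius ?f"
    using assms by (simp add: mseries_conv_iff fps_conv_radius_def)
  also have "\<dots> \<le> fps_conv_radius (fps_deriv ?f)"
    by (rule fps_conv_radius_deriv)
  finally show "R \<le> conv_radius (\<lambda>n. (mat (of_nat (Suc n)) ** a (Suc n)) $ i $ j)"
    by (simp add: fps_conv_radius_def)
qed

text \<open>The matrix of scalar sums is differentiated first. It is known to equal the matrix
  series only inside the disc, where the series converges; the disc is open, so the derivative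
  carries over.\<close>

lemma mderiv_mseries:
  assumes "mseries_conv R a" "ereal (norm z) < R"
  shows "mderiv (mseries a) (mseries (\<lambda>n. mat (of_nat (Suc n)) ** a (Suc n)) z) z"
proof -
  have "mderiv (\<lambda>w. \<chi> i j. \<Sum>n. a n $ i $ j * w ^ n)
      (mseries (\<lambda>n. mat (of_nat (Suc n)) ** a (Suc n)) z) z"
    unfolding mderiv_def
  proof (intro allI)
    fix i j
    have "ereal (norm z) < conv_radius (\<lambda>n. a n $ i $ j)"
      using assms unfolding mseries_conv_iff by (blast intro: order_less_le_trans)
    from has_field_derivative_powser[OF this, of UNIV]
    show "((\<lambda>w. (\<chi> i j. \<Sum>n. a n $ i $ j * w ^ n) $ i $ j) has_field_derivative
        mseries (\<lambda>n. mat (of_nat (Suc n)) ** a (Suc n)) z $ i $ j) (at z)"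
      by (simp add: mseries_nth[OF mseries_convD[OF mseries_conv_diffs[OF assms(1)] assms(2)]]
          diffs_def del: of_nat_Suc)
  qed
  then show ?thesis
  proof (rule mderiv_transform)
    show "open (eball (0::complex) R)" "z \<in> eball 0 R"
      using assms by simp_all
    show "(\<chi> i j. \<Sum>n. a n $ i $ j * w ^ n) = mseries a w" if "w \<in> eball 0 R" for w
      using that mseries_convD[OF assms(1)] by (simp add: vec_eq_iff mseries_nth)
  qed
qed

text \<open>The operator z d/dz multiplies the n-th coefficient by n. The index shift loses nothing
  because the term at n = 0 vanishes.\<close>

lemma mseries_diffs_shift:
  assumes "mseries_conv R a" "ereal (norm z) < R"
  shows "summable (\<lambda>n. mat (z ^ n) ** (mat (of_nat n) ** a n))"
    and "mat z ** mseries (\<lambda>n. mat (of_nat (Suc n)) ** a (Suc n)) z =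
      mseries (\<lambda>n. mat (of_nat n) ** a n) z"
proof -
  let ?g = "\<lambda>n. mat (z ^ n) ** (mat (of_nat n) ** a n)"
  have s: "summable (\<lambda>n. mat (z ^ n) ** (mat (of_nat (Suc n)) ** a (Suc n)))"
    by (rule mseries_convD[OF mseries_conv_diffs[OF assms(1)] assms(2)])
  have "?g (Suc n) = mat z ** (mat (z ^ n) ** (mat (of_nat (Suc n)) ** a (Suc n)))" for n
    by (simp only: matrix_mul_assoc mat_mult_mat power_Suc mult.assoc)
  then have "(\<lambda>n. ?g (Suc n)) sums (mat z ** mseries (\<lambda>n. mat (of_nat (Suc n)) ** a (Suc n)) z)"
    unfolding mseries_def
    using bounded_linear.sums[OF bounded_linear_mult_left summable_sums[OF s], of "mat z"]
    by (simp only:)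
  then have "?g sums (mat z ** mseries (\<lambda>n. mat (of_nat (Suc n)) ** a (Suc n)) z)"
    using sums_Suc[of ?g] by simp
  then show "summable ?g"
    and "mat z ** mseries (\<lambda>n. mat (of_nat (Suc n)) ** a (Suc n)) z =
      mseries (\<lambda>n. mat (of_nat n) ** a n) z"
    unfolding mseries_def by (simp_all add: sums_iff)
qed

lemma mseries_conv_of_nat_mult:
  assumes "mseries_conv R a"
  shows "mseries_conv R (\<lambda>n. mat (of_nat n) ** a n)"
  using mseries_diffs_shift(1)[OF assms] by (simp add: mseries_conv_def)

section \<open>Entire functions of matrices and matrix powers\<close>

lemma mat_power_0 [simp]: "mat_power M 0 = mat 1"
  and mat_power_Suc [simp]: "mat_power M (Suc k) = M ** mat_power M k"
  by (simp_all add: mat_power_def)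

lemma mat_power_mult_mat: "mat_power (M ** mat c) k = mat (c ^ k) ** mat_power M k"
proof (induction k)
  case (Suc k)
  have "M ** mat c ** (mat (c ^ k) ** mat_power M k) = mat (c * c ^ k) ** (M ** mat_power M k)"
    by (simp add: mat_left_commute[of _ M] mat_mult_mat_left flip: matrix_mul_assoc)
  then show ?case using Suc by simp
qed simp

lemma mcommute_mat_power: "mcommute X M \<Longrightarrow> mcommute X (mat_power M k)"
  by (induction k) (simp_all add: mcommute_mult)

text \<open>An entry of a product is a sum of \<open>CARD('n)\<close> products of entries, so every
  multiplication by \<open>M\<close> costs a factor \<open>CARD('n) * b\<close>.\<close>

lemma norm_mat_power_nth_le:
  fixes M :: "complex^'n^'n"
  assumes "\<And>i j. norm (M $ i $ j) \<le> b"
  shows "norm (mat_power M k $ i $ j) \<le> (of_nat CARD('n) * b) ^ k"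
proof (induction k arbitrary: i)
  case 0
  show ?case by (simp add: mat_def)
next
  case (Suc k)
  have "norm ((M ** mat_power M k) $ i $ j) \<le> (\<Sum>l\<in>UNIV. norm (M $ i $ l * mat_power M k $ l $ j))"
    by (simp add: matrix_matrix_mult_def norm_sum)
  also have "\<dots> \<le> (\<Sum>l\<in>(UNIV::'n set). b * (of_nat CARD('n) * b) ^ k)"
    unfolding norm_mult
    by (intro sum_mono mult_mono assms Suc norm_ge_zero order_trans[OF norm_ge_zero assms])
  finally show ?case by simp
qed

lemma mseries_conv_mat_power:
  fixes M :: "complex^'n^'n"
  assumes "conv_radius c = \<infinity>"
  shows "mseries_conv \<infinity> (\<lambda>k. mat (c k) ** mat_power M k)"
  unfolding mseries_conv_iff
proof (intro allI)
  fix i j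
  have b: "norm (M $ i $ j) \<le> norm M" for i j
    by (meson Finite_Cartesian_Product.norm_nth_le order_trans)
  have "conv_radius (\<lambda>k. (mat (c k) ** mat_power M k) $ i $ j) = \<infinity>"
  proof (rule conv_radius_inftyI'')
    fix z :: complex
    \<comment> \<open>With the bound on the entries of \<open>mat_power M k\<close>, the term at
      \<open>z\<close> is dominated by the scalar term at this point.\<close>
    let ?x = "of_nat CARD('n) * norm M * norm z"
    have "summable (\<lambda>k. norm (c k * complex_of_real ?x ^ k))"
      by (rule abs_summable_in_conv_radius) (simp add: assms)
    then show "summable (\<lambda>k. (mat (c k) ** mat_power M k) $ i $ j * z ^ k)"
    proof (rule summable_comparison_test'[where N = 0])
      fix k
      have "norm (mat_power M k $ i $ j) * norm z ^ k \<le> (of_nat CARD('n) * norm M) ^ k * norm z ^ k"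
        by (intro mult_right_mono norm_mat_power_nth_le b) simp
      also have "\<dots> = norm (complex_of_real ?x ^ k)"
        by (simp add: norm_power norm_mult power_mult_distrib)
      finally have "norm (c k) * (norm (mat_power M k $ i $ j) * norm z ^ k) \<le>
          norm (c k) * norm (complex_of_real ?x ^ k)"
        by (rule mult_left_mono) simp
      then show "norm ((mat (c k) ** mat_power M k) $ i $ j * z ^ k) \<le>
          norm (c k * complex_of_real ?x ^ k)"
        by (simp only: mat_mult_nth norm_mult norm_power mult.assoc)
    qed
  qed
  then show "\<infinity> \<le> conv_radius (\<lambda>k. (mat (c k) ** mat_power M k) $ i $ j)" by simp
qed

text \<open>For entire \<open>f\<close> the Taylor coefficients have infinite radius, so
  \<open>entire_mat f M\<close> is a convergent series in the powers of \<open>M\<close>, read as an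
  \<open>mseries\<close> at the point 1. For \<open>rGamma\<close> this lets the C's pass
  Gamma^{-1}(nA+B).\<close>

lemma mcommute_entire_mat:
  assumes "f holomorphic_on UNIV" "mcommute X M"
  shows "mcommute X (entire_mat f M)"
proof -
  let ?c = "\<lambda>k. (deriv ^^ k) f 0 / fact k"
  have "conv_radius ?c = \<infinity>"
  proof (rule conv_radius_inftyI'')
    fix z :: complex
    have "f holomorphic_on ball 0 (norm z + 1)"
      using assms(1) holomorphic_on_subset by blast
    from holomorphic_power_series[OF this, of z] show "summable (\<lambda>k. ?c k * z ^ k)"
      by (simp add: sums_iff)
  qed
  from mseries_convD[OF mseries_conv_mat_power[OF this], of 1]
  have "mcommute X (mseries (\<lambda>k. mat (?c k) ** mat_power M k) 1)"
    using assms(2) by (intro mcommute_mseries mcommute_mult mcommute_mat_power) simp_all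
  then show ?thesis
    by (simp add: mseries_def entire_mat_def)
qed

text \<open>This is exp(tM) as a power series in the scalar t with matrix coefficients, so that
  differentiation in t is termwise.\<close>

definition mexp :: "complex^'n^'n \<Rightarrow> complex \<Rightarrow> complex^'n^'n" where
  "mexp M = mseries (\<lambda>k. mat (1 / fact k) ** mat_power M k)"

lemma powm_eq_mexp: "z powm M = mexp M (Ln z)"
proof -
  have "(deriv ^^ k) exp = (exp :: complex \<Rightarrow> complex)" for k
    by (induction k) (auto intro!: DERIV_imp_deriv DERIV_exp)
  then show ?thesis
    by (simp add: mat_powr_def entire_mat_def mexp_def mseries_def mat_power_mult_mat
        mat_mult_mat matrix_mul_assoc mult.commute)
qed

lemma mseries_conv_mexp: "mseries_conv \<infinity> (\<lambda>k. mat (1 / fact k) ** mat_power M k)"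
proof (rule mseries_conv_mat_power, rule conv_radius_inftyI'')
  fix z :: complex
  show "summable (\<lambda>k. 1 / fact k * z ^ k)"
    using summable_exp[of z] by (simp add: divide_inverse)
qed

lemma mcommute_mexp: "mcommute X M \<Longrightarrow> mcommute X (mexp M t)"
  unfolding mexp_def
  by (intro mcommute_mseries mseries_convD[OF mseries_conv_mexp] mcommute_mult mcommute_mat_power)
    simp_all

lemma mexp_0 [simp]: "mexp M 0 = mat 1"
proof -
  have "mexp M 0 = (\<Sum>n\<in>{0::nat}. mat (0 ^ n) ** (mat (1 / fact n) ** mat_power M n))"
    unfolding mexp_def mseries_def by (rule suminf_finite) (auto simp: power_0_left)
  then show ?thesis by simp
qed

lemma mderiv_mexp: "mderiv (mexp M) (M ** mexp M t) t"
proof -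
  let ?a = "\<lambda>k. mat (1 / fact k) ** mat_power M k"
  have "mat (of_nat (Suc k)) ** ?a (Suc k) = M ** ?a k" for k
  proof -
    have "mat (of_nat (Suc k)) ** ?a (Suc k) =
        mat (of_nat (Suc k) * (1 / fact (Suc k))) ** (M ** mat_power M k)"
      by (simp only: matrix_mul_assoc mat_mult_mat mat_power_Suc)
    also have "complex_of_nat (Suc k) * (1 / fact (Suc k)) = 1 / fact k"
      by (simp add: divide_simps del: of_nat_Suc)
    finally show ?thesis
      by (simp only: mat_left_commute[of _ M])
  qed
  then have "mseries (\<lambda>k. mat (of_nat (Suc k)) ** ?a (Suc k)) t = M ** mexp M t"
    using mseries_mult_left(2)[OF mseries_convD[OF mseries_conv_mexp, of t]]
    by (simp add: mexp_def del: of_nat_Suc mat_power_Suc)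
  then show ?thesis
    using mderiv_mseries[OF mseries_conv_mexp, of t M] by (simp add: mexp_def del: of_nat_Suc)
qed

lemma mderiv_zero_imp_constant:
  assumes "\<And>z. mderiv F 0 z"
  shows "F z = F 0"
proof -
  have "F z $ i $ j = F 0 $ i $ j" for i j
    using has_field_derivative_zero_constant[of UNIV "\<lambda>w. F w $ i $ j"] assms
    by (fastforce simp: mderiv_def)
  then show ?thesis by (simp add: vec_eq_iff)
qed

text \<open>It serves twice for the shift law below: with c = 0 and -M in place of M it shows that
  exp(-tM) inverts exp(tM), and for general c it supplies the scalar factor.\<close>

lemma mexp_uminus_mult: "mexp (- M) t ** mexp (M + mat c) t = mat (exp (c * t))"
proof -
  define H where "H t = mat (exp (- c * t)) ** (mexp (- M) t ** mexp (M + mat c) t)" for t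
  have "mderiv H 0 t" for t
  proof -
    let ?E = "mexp (- M) t" and ?E' = "mexp (M + mat c) t" and ?e = "exp (- c * t)"
    have "mcommute M (- M)"
      by (intro mcommute_uminus mcommute_refl)
    then have comm: "M ** ?E = ?E ** M"
      using mcommute_mexp by (auto simp: mcommute_def)
    have "mderiv (\<lambda>t. mat (exp (- c * t))) (mat (- c * ?e)) t"
      by (intro mderiv_mat derivative_eq_intros) auto
    from mderiv_mult[OF this mderiv_mult[OF mderiv_mexp mderiv_mexp]]
    have "mderiv H (mat (- c * ?e) ** (?E ** ?E') +
        mat ?e ** ((- M) ** ?E ** ?E' + ?E ** ((M + mat c) ** ?E'))) t"
      unfolding H_def .
    also have "?E ** ((M + mat c) ** ?E') = ?E ** M ** ?E' + ?E ** (mat c ** ?E')"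
      by (simp only: matrix_add_rdistrib' matrix_add_ldistrib matrix_mul_assoc)
    also have "?E ** M = M ** ?E"
      by (rule comm[symmetric])
    also have "?E ** (mat c ** ?E') = mat c ** (?E ** ?E')"
      by (rule mat_left_commute[symmetric])
    also have "(- M) ** ?E ** ?E' + (M ** ?E ** ?E' + mat c ** (?E ** ?E')) = mat c ** (?E ** ?E')"
      by (simp add: matrix_uminus_left)
    also have "mat (- c * ?e) ** (?E ** ?E') + mat ?e ** (mat c ** (?E ** ?E')) = 0"
      by (simp add: mat_mult_mat_left vec_eq_iff mult.commute)
    finally show ?thesis .
  qed
  then have "H t = H 0" by (rule mderiv_zero_imp_constant)
  then have "mat (exp (c * t)) ** H t = mat (exp (c * t))"
    by (simp add: H_def)
  then show ?thesis
    by (simp add: H_def mat_mult_mat_left flip: exp_add)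
qed

lemma mexp_add_mat: "mexp (M + mat c) t = mat (exp (c * t)) ** mexp M t"
proof -
  have "mexp M t ** mexp (- M) t = mat 1"
    using mexp_uminus_mult[of "- M" t 0] by simp
  then have "mexp (M + mat c) t = mexp M t ** (mexp (- M) t ** mexp (M + mat c) t)"
    by (simp add: matrix_mul_assoc)
  then show ?thesis
    by (simp add: mexp_uminus_mult mult_mat_commute)
qed

text \<open>For a natural number k, exp(k Ln z) = z^k whatever the branch of the logarithm, so this
  holds on the cut too.\<close>

lemma powm_add_of_nat: "z \<noteq> 0 \<Longrightarrow> z powm (M + mat (of_nat k)) = mat (z ^ k) ** z powm M"
  by (simp add: powm_eq_mexp mexp_add_mat exp_of_nat_mult)

lemma mcommute_powm: "mcommute X M \<Longrightarrow> mcommute X (z powm M)"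
  by (simp add: powm_eq_mexp mcommute_mexp)

lemma mderiv_powm:
  assumes "z \<notin> \<real>\<^sub>\<le>\<^sub>0"
  shows "mderiv (\<lambda>z. z powm M) (mat (1 / z) ** (M ** z powm M)) z"
  using mderiv_chain[OF mderiv_mexp has_field_derivative_Ln[OF assms]]
  by (simp add: powm_eq_mexp inverse_eq_divide)

section \<open>Iterated derivatives of matrix power series\<close>

lemma iterate_mat_deriv_mseries:
  assumes "mseries_conv R a"
  shows "mat_holomorphic_on (mseries a) (eball 0 R)"
    and "ereal (norm z) < R \<Longrightarrow>
      (mat_deriv ^^ r) (mseries a) z = mseries (\<lambda>n. mat (fact (n + r) / fact n) ** a (n + r)) z"
proof -
  \<comment> \<open>The coefficients after \<open>k\<close> differentiations.\<close>
  define b where "b k n = mat (fact (n + k) / fact n) ** a (n + k)" for k n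
  have b_Suc: "b (Suc k) = (\<lambda>n. mat (of_nat (Suc n)) ** b k (Suc n))" for k
    by (simp add: b_def fun_eq_iff mat_mult_mat_left divide_simps del: of_nat_Suc)
  have conv: "mseries_conv R (b k)" for k
  proof (induction k)
    case 0
    show ?case using assms by (simp add: b_def)
  next
    case (Suc k)
    then show ?case unfolding b_Suc by (rule mseries_conv_diffs)
  qed
  have deriv: "mderiv (mseries (b k)) (mseries (b (Suc k)) z) z" if "z \<in> eball 0 R" for k z
    unfolding b_Suc by (rule mderiv_mseries[OF conv]) (use that in simp)
  have b_0: "b 0 = a" by (simp add: b_def fun_eq_iff)
  show "mat_holomorphic_on (mseries a) (eball 0 R)"
    unfolding b_0[symmetric] by (rule mderiv_imp_holomorphic[OF deriv])
  show "(mat_deriv ^^ r) (mseries a) z = mseries (\<lambda>n. mat (fact (n + r) / fact n) ** a (n + r)) z"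
    if "ereal (norm z) < R"
    using mat_deriv_iterate[of "eball 0 R" "\<lambda>k. mseries (b k)" z r, OF _ deriv] that
    by (simp add: b_0) (simp add: b_def[abs_def])
qed

text \<open>Written with 1/z the derivative keeps the index of the coefficients, and its factor 1/z
  matches the one from the derivative of z^M.\<close>

lemma mderiv_mseries':
  assumes "mseries_conv R a" "ereal (norm z) < R" "z \<noteq> 0"
  shows "mderiv (mseries a) (mat (1 / z) ** mseries (\<lambda>n. mat (of_nat n) ** a n) z) z"
  using mderiv_mseries[OF assms(1,2)] assms(3)
  by (simp add: mseries_diffs_shift(2)[OF assms(1,2), symmetric] mat_mult_mat_left)

text \<open>Differentiating a_n z^(M+nI) r times yields the factors M+nI, ..., M+(n-r+1)I, which
  commute and are read upwards as a Pochhammer symbol. The differences are complex numbers, so n < r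
  is no exception. Convergence of \<open>b\<close> is a conclusion because it later gives that of
  the series with lowered D_j.\<close>

lemma iterate_mat_deriv_mseries_powm:
  fixes M :: "complex^'n^'n" and r :: nat
  assumes "mseries_conv R a"
  defines "S \<equiv> eball 0 R - \<real>\<^sub>\<le>\<^sub>0"
    and "b \<equiv> \<lambda>n. a n ** mat_pochhammer (M + mat (of_nat n - of_nat r + 1)) r"
  shows "mseries_conv R b"
    and "mat_holomorphic_on (\<lambda>z. mseries a z ** z powm M) S"
    and "z \<in> S \<Longrightarrow> (mat_deriv ^^ r) (\<lambda>z. mseries a z ** z powm M) z =
      mseries b z ** z powm (M - mat (of_nat r))"
proof -
  define c where "c k n = a n ** mat_pochhammer (M + mat (of_nat n - of_nat k + 1)) k" for k n
  \<comment> \<open>The new factor M+(n-k)I is the first one of the longer Pochhammer product and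
    has to move to its end. It splits into M-kI, from differentiating z^(M-kI), and nI, from
    differentiating the series.\<close>
  have c_Suc: "c (Suc k) n = c k n ** (M - mat (of_nat k)) + mat (of_nat n) ** c k n" for k n
  proof -
    let ?Y = "M + mat (of_nat n - of_nat k)" and ?X = "M + mat (of_nat n - of_nat k + 1)"
    have "mat_pochhammer ?Y (Suc k) = ?Y ** mat_pochhammer ?X k"
      by (simp add: mat_pochhammer_Suc_left add.assoc mat_add_mat)
    also have "\<dots> = mat_pochhammer ?X k ** ?Y"
      by (intro mcommuteD mcommute_pochhammer mcommute_shift)
    finally have "c (Suc k) n = c k n ** (M - mat (of_nat k) + mat (of_nat n))"
      by (simp add: c_def matrix_mul_assoc diff_mat add.assoc mat_add_mat)
    then show ?thesis
      by (simp add: matrix_add_ldistrib mult_mat_commute)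
  qed
  have conv: "mseries_conv R (c k)" for k
  proof (induction k)
    case 0
    show ?case using assms by (simp add: c_def)
  next
    case (Suc k)
    then show ?case unfolding c_Suc[abs_def]
      by (intro mseries_conv_add mseries_conv_mult_right mseries_conv_of_nat_mult)
  qed
  have "open S" unfolding S_def by (intro open_Diff open_eball closed_nonpos_Reals_complex)
  define G where "G k z = mseries (c k) z ** z powm (M - mat (of_nat k))" for k z
  have deriv: "mderiv (G k) (G (Suc k) z) z" if "z \<in> S" for k z
  proof -
    have z: "ereal (norm z) < R" "z \<noteq> 0" "z \<notin> \<real>\<^sub>\<le>\<^sub>0"
      using that by (auto simp: S_def)
    let ?N = "M - mat (of_nat k)" and ?s = "mseries (c k) z"
      and ?t = "mseries (\<lambda>n. mat (of_nat n) ** c k n) z"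
    let ?P = "z powm ?N"
    note sums = mseries_convD[OF conv[of k] z(1)]
    \<comment> \<open>The shift law raises exponents; applied to M-(k+1)I and divided by z, it
      lowers them.\<close>
    have "M - mat (of_nat (Suc k)) + mat (of_nat 1) = ?N"
      by (simp add: diff_mat add.assoc mat_add_mat)
    then have "?P = mat z ** z powm (M - mat (of_nat (Suc k)))"
      using powm_add_of_nat[OF z(2), of "M - mat (of_nat (Suc k))" 1]
      by (simp only: power_one_right)
    then have P: "z powm (M - mat (of_nat (Suc k))) = mat (1 / z) ** ?P"
      using z(2) by (simp add: mat_mult_mat_left)
    have "mseries (c (Suc k)) z = ?s ** ?N + ?t"
      using mseries_add[OF mseries_mult_right(1)[OF sums, of ?N]
          mseries_convD[OF mseries_conv_of_nat_mult[OF conv[of k]] z(1)]]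
      by (simp only: c_Suc[abs_def] mseries_mult_right(2)[OF sums])
    then have "G (Suc k) z = ?t ** (mat (1 / z) ** ?P) + ?s ** ?N ** (mat (1 / z) ** ?P)"
      by (simp only: G_def P matrix_add_rdistrib' add.commute)
    also have "?t ** (mat (1 / z) ** ?P) = mat (1 / z) ** ?t ** ?P"
      by (simp only: mat_left_commute[symmetric] matrix_mul_assoc[symmetric])
    also have "?s ** ?N ** (mat (1 / z) ** ?P) = ?s ** (mat (1 / z) ** (?N ** ?P))"
      by (simp only: mat_left_commute matrix_mul_assoc[symmetric])
    finally show ?thesis
      using mderiv_mult[OF mderiv_mseries'[OF conv[of k] z(1,2)] mderiv_powm[OF z(3), of ?N]]
      by (simp only: G_def[abs_def])
  qed
  have "c 0 = a"
    by (simp add: c_def[abs_def])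
  then have G_0: "G 0 = (\<lambda>z. mseries a z ** z powm M)"
    by (simp add: G_def[abs_def])
  show "mseries_conv R b"
    using conv[of r] by (simp add: b_def c_def[abs_def])
  show "mat_holomorphic_on (\<lambda>z. mseries a z ** z powm M) S"
    unfolding G_0[symmetric] by (rule mderiv_imp_holomorphic[OF deriv])
  show "(mat_deriv ^^ r) (\<lambda>z. mseries a z ** z powm M) z = mseries b z ** z powm (M - mat (of_nat r))"
    if "z \<in> S"
    using mat_deriv_iterate[of S G z r, OF \<open>open S\<close> deriv that]
    unfolding G_0 by (simp add: G_def b_def c_def[abs_def])
qed

text \<open>Here z^2 d/dz raises the exponent: step k multiplies by M+(n+k)I, where M+kI comes from
  the power and nI from the series.\<close>

lemma iterate_z2_deriv_powm_mseries:
  assumes "mseries_conv R a"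
  defines "S \<equiv> eball 0 R - \<real>\<^sub>\<le>\<^sub>0"
  shows "mat_holomorphic_on (\<lambda>z. z powm M ** mseries a z) S"
    and "z \<in> S \<Longrightarrow> (z2_deriv ^^ r) (\<lambda>z. z powm M ** mseries a z) z =
      z powm (M + mat (of_nat r)) ** mseries (\<lambda>n. mat_pochhammer (M + mat (of_nat n)) r ** a n) z"
proof -
  define c where "c k n = mat_pochhammer (M + mat (of_nat n)) k ** a n" for k n
  have c_Suc: "c (Suc k) n = (M + mat (of_nat k)) ** c k n + mat (of_nat n) ** c k n" for k n
  proof -
    let ?p = "mat_pochhammer (M + mat (of_nat n)) k" and ?Y = "M + mat (of_nat k) + mat (of_nat n)"
    have "mat_pochhammer (M + mat (of_nat n)) (Suc k) = ?p ** ?Y"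
      by (simp add: mat_pochhammer_Suc ac_simps)
    also have "\<dots> = ?Y ** ?p"
      unfolding add.assoc mat_add_mat by (intro mcommuteD[symmetric] mcommute_pochhammer mcommute_shift)
    finally show ?thesis
      by (simp add: c_def matrix_add_rdistrib' matrix_mul_assoc)
  qed
  have conv: "mseries_conv R (c k)" for k
  proof (induction k)
    case 0
    show ?case using assms by (simp add: c_def)
  next
    case (Suc k)
    then show ?case unfolding c_Suc[abs_def]
      by (intro mseries_conv_add mseries_conv_mult_left mseries_conv_of_nat_mult)
  qed
  have "open S" unfolding S_def by (intro open_Diff open_eball closed_nonpos_Reals_complex)
  define G where "G k z = z powm (M + mat (of_nat k)) ** mseries (c k) z" for k z
  define G' where "G' k z =
    mat (1 / z) ** ((M + mat (of_nat k)) ** z powm (M + mat (of_nat k))) ** mseries (c k) z +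
    z powm (M + mat (of_nat k)) ** (mat (1 / z) ** mseries (\<lambda>n. mat (of_nat n) ** c k n) z)" for k z
  have z: "ereal (norm z) < R" "z \<noteq> 0" "z \<notin> \<real>\<^sub>\<le>\<^sub>0" if "z \<in> S" for z
    using that by (auto simp: S_def)
  have deriv: "mderiv (G k) (G' k z) z" if "z \<in> S" for k z
    unfolding G_def G'_def using that by (intro mderiv_mult mderiv_mseries'[OF conv] mderiv_powm z)
  have G': "mat (z ^ 2) ** G' k z = G (Suc k) z" if "z \<in> S" for k z
  proof -
    note z = z[OF that]
    let ?N = "M + mat (of_nat k)" and ?s = "mseries (c k) z"
      and ?t = "mseries (\<lambda>n. mat (of_nat n) ** c k n) z"
    let ?P = "z powm ?N"
    note sums = mseries_convD[OF conv[of k] z(1)]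
    have N: "M + mat (of_nat (Suc k)) = ?N + mat (of_nat 1)"
      by (simp add: add.assoc mat_add_mat add.commute)
    have P: "z powm (M + mat (of_nat (Suc k))) = mat z ** ?P"
      using powm_add_of_nat[OF z(2), of ?N 1] by (simp only: N power_one_right)
    have comm: "?N ** ?P = ?P ** ?N"
      by (intro mcommuteD mcommute_powm mcommute_refl)
    have "mseries (c (Suc k)) z = ?N ** ?s + ?t"
      using mseries_add[OF mseries_mult_left(1)[OF sums, of ?N]
          mseries_convD[OF mseries_conv_of_nat_mult[OF conv[of k]] z(1)]]
      by (simp only: c_Suc[abs_def] mseries_mult_left(2)[OF sums])
    then have "G (Suc k) z = mat z ** (?P ** (?N ** ?s) + ?P ** ?t)"
      by (simp only: G_def P matrix_add_ldistrib matrix_mul_assoc)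
    also have "mat z = mat (z ^ 2) ** mat (1 / z)"
      using z(2) by (simp add: mat_mult_mat power2_eq_square)
    finally have "G (Suc k) z = mat (z ^ 2) ** (mat (1 / z) ** (?P ** (?N ** ?s)) + mat (1 / z) ** (?P ** ?t))"
      by (simp only: matrix_add_ldistrib matrix_mul_assoc)
    also have "?P ** (?N ** ?s) = ?N ** ?P ** ?s"
      unfolding comm by (simp only: matrix_mul_assoc)
    also have "mat (1 / z) ** (?P ** ?t) = ?P ** (mat (1 / z) ** ?t)"
      by (rule mat_left_commute)
    finally show ?thesis
      by (simp only: G'_def matrix_mul_assoc)
  qed
  have "c 0 = a"
    by (simp add: c_def[abs_def])
  then have G_0: "G 0 = (\<lambda>z. z powm M ** mseries a z)"
    by (simp add: G_def[abs_def])
  show "mat_holomorphic_on (\<lambda>z. z powm M ** mseries a z) S"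
    unfolding G_0[symmetric] by (rule mderiv_imp_holomorphic[OF deriv])
  show "(z2_deriv ^^ r) (\<lambda>z. z powm M ** mseries a z) z =
      z powm (M + mat (of_nat r)) ** mseries (\<lambda>n. mat_pochhammer (M + mat (of_nat n)) r ** a n) z"
    if "z \<in> S"
    using z2_deriv_iterate[of S G G' z r, OF \<open>open S\<close> deriv G' that]
    unfolding G_0 by (simp add: G_def c_def[abs_def])
qed

section \<open>Contiguity of the coefficients\<close>

lemma mcommute_pochhammer_both:
  "mcommute X Y \<Longrightarrow> mcommute (mat_pochhammer X k) (mat_pochhammer Y l)"
  by (intro mcommute_pochhammer mcommute_sym[OF mcommute_pochhammer[OF mcommute_sym]])

lemma mcommute_add_mat_left: "mcommute X Y \<Longrightarrow> mcommute (X + mat c) Y"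
  by (rule mcommute_sym, rule mcommute_add[OF mcommute_sym]) simp_all

lemma mcommute_rGamma:
  assumes "mcommute X A" "mcommute X B"
  shows "mcommute X (entire_mat rGamma (mat (of_nat n) ** A + B))"
  by (intro mcommute_entire_mat holomorphic_rGamma mcommute_add mcommute_mult mcommute_mat assms)

lemma admissible_invertible_pochhammer:
  assumes "admissible Ds" "D \<in> set Ds"
  shows "invertible (mat_pochhammer D n)"
  by (rule invertible_mat_pochhammer) (use assms in \<open>simp add: admissible_def\<close>)

text \<open>The r-part of each numerator symbol goes to the left end and that of each denominator
  symbol to the right end. The argument (n+r)A+B is reread as nA+(rA+B), which is where the new B
  comes from.\<close>

lemma pRq_coeff_add:
  assumes "admissible Ds"
    and C: "\<And>C C'. C \<in> set Cs \<Longrightarrow> C' \<in> set Cs \<Longrightarrow> mcommute C C'"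
    and CA: "\<And>C. C \<in> set Cs \<Longrightarrow> mcommute C A" and CB: "\<And>C. C \<in> set Cs \<Longrightarrow> mcommute C B"
    and D: "\<And>D D'. D \<in> set Ds \<Longrightarrow> D' \<in> set Ds \<Longrightarrow> mcommute D D'"
  shows "mat (fact (n + r) / fact n) ** pRq_coeff Cs Ds A B (n + r) =
    mat_prod (map (\<lambda>C. mat_pochhammer C r) Cs) **
    pRq_coeff (map (\<lambda>C. C + mat (of_nat r)) Cs) (map (\<lambda>D. D + mat (of_nat r)) Ds)
      A (mat (of_nat r) ** A + B) n **
    mat_prod (map (\<lambda>D. matrix_inv (mat_pochhammer D r)) Ds)"
proof -
  define \<Gamma> where "\<Gamma> = entire_mat rGamma (mat (of_nat (n + r)) ** A + B)"
  define L where "L = mat_prod (map (\<lambda>C. mat_pochhammer C r) Cs)"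
  define P where "P = mat_prod (map (\<lambda>C. mat_pochhammer (C + mat (of_nat r)) n) Cs)"
  define Q where "Q = mat_prod (map (\<lambda>D. matrix_inv (mat_pochhammer (D + mat (of_nat r)) n)) Ds)"
  define R where "R = mat_prod (map (\<lambda>D. matrix_inv (mat_pochhammer D r)) Ds)"
  have inv: "invertible (mat_pochhammer D r)" "invertible (mat_pochhammer (D + mat (of_nat r)) n)"
    if "D \<in> set Ds" for D
    using assms(1) that unfolding admissible_def
    by (auto intro!: invertible_mat_pochhammer simp: add.assoc mat_add_mat simp flip: of_nat_add)
  have "mat_prod (map (\<lambda>C. mat_pochhammer C (n + r)) Cs) = L ** P"
    unfolding add.commute[of n r] mat_pochhammer_add L_def P_def
    by (intro mat_prod_map_mult mcommute_pochhammer_both mcommute_add C mcommute_mat)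
  moreover have "mat_prod (map (\<lambda>D. matrix_inv (mat_pochhammer D (n + r))) Ds) = Q ** R"
  proof -
    \<comment> \<open>Inversion reverses (D)_r (D+rI)_n, so the inverse of (D)_r already stands on
      the right of its pair.\<close>
    have "map (\<lambda>D. matrix_inv (mat_pochhammer D (n + r))) Ds =
        map (\<lambda>D. matrix_inv (mat_pochhammer (D + mat (of_nat r)) n) **
          matrix_inv (mat_pochhammer D r)) Ds"
      unfolding add.commute[of n r] mat_pochhammer_add by (simp add: matrix_inv_mult inv)
    also have "mat_prod \<dots> = Q ** R"
      unfolding Q_def R_def
    proof (rule mat_prod_map_mult)
      fix D D' assume "D \<in> set Ds" "D' \<in> set Ds"
      then show "mcommute (matrix_inv (mat_pochhammer (D + mat (of_nat r)) n))
          (matrix_inv (mat_pochhammer D' r))"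
        by (intro mcommute_matrix_inv inv mcommute_sym[OF mcommute_matrix_inv]
            mcommute_pochhammer_both mcommute_add mcommute_mat D)
    qed
    finally show ?thesis .
  qed
  ultimately have "mat (fact (n + r) / fact n) ** pRq_coeff Cs Ds A B (n + r) =
      mat (fact (n + r) / fact n) ** (mat (1 / fact (n + r)) ** (\<Gamma> ** (L ** P) ** (Q ** R)))"
    by (simp only: pRq_coeff_def \<Gamma>_def)
  also have "\<dots> = mat (1 / fact n) ** (\<Gamma> ** (L ** P) ** (Q ** R))"
    by (simp only: mat_mult_mat_left) simp
  also have "\<Gamma> ** (L ** P) = L ** (\<Gamma> ** P)"
  proof -
    have "mcommute \<Gamma> (mat_pochhammer C r)" if "C \<in> set Cs" for C
      unfolding \<Gamma>_def using that
      by (intro mcommute_pochhammer mcommute_sym[OF mcommute_rGamma] CA CB)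
    then have "mcommute \<Gamma> L"
      unfolding L_def by (intro mcommute_mat_prod) auto
    then show ?thesis by (simp add: mcommute_def matrix_mul_assoc)
  qed
  also have "mat (1 / fact n) ** (L ** (\<Gamma> ** P) ** (Q ** R)) =
      L ** (mat (1 / fact n) ** (\<Gamma> ** P ** Q)) ** R"
    by (simp only: mat_left_commute[of _ L] matrix_mul_assoc[symmetric])
  also have "\<Gamma> = entire_mat rGamma (mat (of_nat n) ** A + (mat (of_nat r) ** A + B))"
    by (simp add: \<Gamma>_def matrix_add_rdistrib' add.assoc flip: mat_add_mat)
  finally show ?thesis
    by (simp add: pRq_coeff_def L_def P_def Q_def R_def o_def)
qed

text \<open>Only D_j is known to commute with the other denominator parameters, so a single entry is
  exchanged and the others keep their order.\<close>

lemma pRq_coeff_lower_denominator: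
  assumes j: "j < length Ds" and comm: "\<And>D. D \<in> set Ds \<Longrightarrow> mcommute D (Ds ! j)"
    and adm: "admissible Ds" "admissible (Ds[j := Ds ! j - mat (of_nat r)])"
  shows "pRq_coeff Cs Ds A B n ** mat_pochhammer (Ds ! j + mat (of_nat n - of_nat r)) r =
    pRq_coeff Cs (Ds[j := Ds ! j - mat (of_nat r)]) A B n ** mat_pochhammer (Ds ! j - mat (of_nat r)) r"
proof -
  define E where "E = Ds ! j - mat (of_nat r)"
  let ?Es = "Ds[j := E]" and ?inv = "\<lambda>D. matrix_inv (mat_pochhammer D n)"
  let ?X = "mat_pochhammer (Ds ! j + mat (of_nat n - of_nat r)) r" and ?Y = "mat_pochhammer E r"
  let ?U = "mat_pochhammer (Ds ! j) n" and ?V = "mat_pochhammer E n"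
  have adm': "admissible ?Es"
    using adm(2) by (simp only: E_def)
  have inv: "invertible (mat_pochhammer D n)" if "D \<in> set Ds \<or> D \<in> set ?Es" for D
    using that admissible_invertible_pochhammer[OF adm(1)] admissible_invertible_pochhammer[OF adm']
    by blast
  have E: "E \<in> set ?Es" using j by (rule set_update_memI)
  have comm': "mcommute (Ds ! j) D" if "D \<in> set Ds \<or> D \<in> set ?Es" for D
  proof (cases "D \<in> set Ds")
    case True
    then show ?thesis by (rule mcommute_sym[OF comm])
  next
    case False
    then have "D = E" using that set_update_subset_insert by fastforce
    then show ?thesis by (simp add: E_def mcommute_diff_mat)
  qed
  have X: "mcommute ?X (?inv D)" if "D \<in> set Ds" for D
    using that
    by (intro mcommute_matrix_inv mcommute_pochhammer_both mcommute_add_mat_left comm' inv) auto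
  have "mcommute E D" if "D \<in> set Ds \<or> D \<in> set ?Es" for D
    unfolding E_def diff_mat by (rule mcommute_add_mat_left[OF comm'[OF that]])
  then have Y: "mcommute ?Y (?inv D)" if "D \<in> set ?Es" for D
    using that by (intro mcommute_matrix_inv mcommute_pochhammer_both inv) auto
  have E_r: "E + mat (of_nat r) = Ds ! j" and E_n: "E + mat (of_nat n) = Ds ! j + mat (of_nat n - of_nat r)"
    by (simp_all add: E_def diff_mat mat_add_mat add.assoc)
  \<comment> \<open>With E = D_j-rI, the symbol (E)_(r+n) is split at r and at n. Multiplying by the
    inverse of (E)_n on the left and of (D_j)_n on the right isolates the exchange of the
    entry.\<close>
  have "?Y ** ?U = mat_pochhammer E (r + n)"
    by (simp only: mat_pochhammer_add E_r)
  also have "\<dots> = ?V ** ?X"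
    by (simp only: add.commute[of r n] mat_pochhammer_add E_n)
  finally have "?Y ** ?U = ?V ** ?X" .
  then have "?inv E ** (?Y ** ?U) ** ?inv (Ds ! j) = ?inv E ** (?V ** ?X) ** ?inv (Ds ! j)"
    by simp
  then have "(?inv E ** ?Y) ** (?U ** ?inv (Ds ! j)) = (?inv E ** ?V) ** (?X ** ?inv (Ds ! j))"
    by (simp only: matrix_mul_assoc)
  then have "?inv E ** ?Y = ?X ** ?inv (Ds ! j)"
    using inv[of E] inv[of "Ds ! j"] E j by (simp add: matrix_inv_inverts)
  also have "\<dots> = ?inv (Ds ! j) ** ?X"
    using j by (intro mcommuteD X) simp
  finally have eq: "?inv E ** ?Y = ?inv (Ds ! j) ** ?X" .
  have "mat_prod (map ?inv Ds) ** ?X = mat_prod ((map ?inv Ds)[j := map ?inv Ds ! j ** ?X])"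
    using j X by (intro mat_prod_update_mult[symmetric]) auto
  also have "(map ?inv Ds)[j := map ?inv Ds ! j ** ?X] = (map ?inv ?Es)[j := map ?inv ?Es ! j ** ?Y]"
    using j by (simp add: eq map_update)
  also have "mat_prod \<dots> = mat_prod (map ?inv ?Es) ** ?Y"
    using j Y by (intro mat_prod_update_mult) auto
  finally show ?thesis
    by (simp add: pRq_coeff_def E_def flip: matrix_mul_assoc)
qed

text \<open>(C_i)_(n+r) is split at n and at r. Since (C_i)_r may be singular, the relation stays a
  product and is not solved for the raised coefficient.\<close>

lemma pRq_coeff_raise_numerator:
  assumes i: "i < length Cs" and C: "\<And>C. C \<in> set Cs \<Longrightarrow> mcommute (Cs ! i) C"
    and "mcommute (Cs ! i) A" "mcommute (Cs ! i) B"
  shows "mat_pochhammer (Cs ! i + mat (of_nat n)) r ** pRq_coeff Cs Ds A B n =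
    mat_pochhammer (Cs ! i) r ** pRq_coeff (Cs[i := Cs ! i + mat (of_nat r)]) Ds A B n"
proof -
  let ?poch = "\<lambda>C. mat_pochhammer C n"
  define E where "E = Cs ! i + mat (of_nat r)"
  define X where "X = mat_pochhammer (Cs ! i + mat (of_nat n)) r"
  define Y where "Y = mat_pochhammer (Cs ! i) r"
  define \<Gamma> where "\<Gamma> = entire_mat rGamma (mat (of_nat n) ** A + B)"
  have X: "mcommute X Z" if "mcommute (Cs ! i) Z" for Z
    unfolding X_def
    by (rule mcommute_sym, intro mcommute_pochhammer mcommute_add mcommute_mat mcommute_sym[OF that])
  have Y: "mcommute Y Z" if "mcommute (Cs ! i) Z" for Z
    unfolding Y_def by (rule mcommute_sym, intro mcommute_pochhammer mcommute_sym[OF that])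
  have C': "mcommute (Cs ! i) Z" if "Z \<in> set (Cs[i := E])" for Z
  proof -
    have "Z = E \<or> Z \<in> set Cs"
      using that set_update_subset_insert by fastforce
    then show ?thesis by (auto intro: C simp: E_def mcommute_add)
  qed
  have PC: "mcommute (Cs ! i) (?poch Z)" if "Z \<in> set Cs \<or> Z \<in> set (Cs[i := E])" for Z
    using that by (auto intro: mcommute_pochhammer C C')
  have \<Gamma>: "mcommute (Cs ! i) \<Gamma>"
    unfolding \<Gamma>_def by (intro mcommute_rGamma assms)
  have "?poch (Cs ! i) ** X = Y ** ?poch E"
    using mat_pochhammer_add[of "Cs ! i" n r] mat_pochhammer_add[of "Cs ! i" r n]
    by (simp add: X_def Y_def E_def add.commute)
  also have "\<dots> = ?poch E ** Y"
    by (intro mcommuteD Y mcommute_pochhammer) (simp add: E_def mcommute_add)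
  finally have eq: "?poch (Cs ! i) ** X = ?poch E ** Y" .
  have "mat_prod (map ?poch Cs) ** X = mat_prod ((map ?poch Cs)[i := map ?poch Cs ! i ** X])"
    using i by (intro mat_prod_update_mult[symmetric]) (auto intro!: X PC)
  also have "(map ?poch Cs)[i := map ?poch Cs ! i ** X] =
      (map ?poch (Cs[i := E]))[i := map ?poch (Cs[i := E]) ! i ** Y]"
    using i by (simp add: eq map_update)
  also have "mat_prod \<dots> = mat_prod (map ?poch (Cs[i := E])) ** Y"
    using i by (intro mat_prod_update_mult) (auto intro!: Y PC)
  finally have prod: "mat_prod (map ?poch Cs) ** X = mat_prod (map ?poch (Cs[i := E])) ** Y" .
  let ?Q = "mat_prod (map (\<lambda>D. matrix_inv (mat_pochhammer D n)) Ds)"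
  \<comment> \<open>Stated for general \<open>Z\<close> and \<open>Zs\<close> because both sides are
    instances: \<open>X\<close> with the original list and \<open>Y\<close> with the updated
    one.\<close>
  have pull: "Z ** (mat (1 / fact n) ** (\<Gamma> ** mat_prod Zs ** ?Q)) =
      mat (1 / fact n) ** (\<Gamma> ** (mat_prod Zs ** Z) ** ?Q)"
    if "mcommute Z \<Gamma>" "\<And>W. W \<in> set Zs \<Longrightarrow> mcommute Z W" for Z Zs
  proof -
    have "mcommute Z (\<Gamma> ** mat_prod Zs)"
      by (intro mcommute_mult mcommute_mat_prod that)
    then have comm: "Z ** (\<Gamma> ** mat_prod Zs) = \<Gamma> ** mat_prod Zs ** Z"
      by (rule mcommuteD)
    have "Z ** (mat (1 / fact n) ** (\<Gamma> ** mat_prod Zs ** ?Q)) =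
        mat (1 / fact n) ** (Z ** (\<Gamma> ** mat_prod Zs ** ?Q))"
      by (rule mat_left_commute[symmetric])
    also have "Z ** (\<Gamma> ** mat_prod Zs ** ?Q) = Z ** (\<Gamma> ** mat_prod Zs) ** ?Q"
      by (simp only: matrix_mul_assoc)
    also have "\<dots> = \<Gamma> ** (mat_prod Zs ** Z) ** ?Q"
      unfolding comm by (simp only: matrix_mul_assoc)
    finally show ?thesis .
  qed
  have "X ** pRq_coeff Cs Ds A B n = Y ** pRq_coeff (Cs[i := E]) Ds A B n"
    unfolding pRq_coeff_def \<Gamma>_def[symmetric]
    by (subst (1 2) pull)
      (auto intro!: X Y \<Gamma> PC simp: prod)
  then show ?thesis by (simp add: X_def Y_def E_def)
qed

text \<open>The factors on the left are X-kI for 1 <= k <= r, and X-kI = -((I-X)+(k-1)I). The order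
  is reversed, but these factors commute.\<close>

lemma mat_pochhammer_reflect:
  "mat_pochhammer (X - mat (of_nat r)) r = mat ((-1) ^ r) ** mat_pochhammer (mat 1 - X) r"
proof (induction r)
  case (Suc r)
  let ?p = "mat_pochhammer (mat 1 - X) r" and ?Y = "mat 1 - X + mat (of_nat r)"
  have "X - mat (of_nat (Suc r)) + mat 1 = X - mat (of_nat r)"
    by (simp add: diff_mat add.assoc mat_add_mat)
  then have "mat_pochhammer (X - mat (of_nat (Suc r))) (Suc r) =
      (X - mat (of_nat (Suc r))) ** (mat ((-1) ^ r) ** ?p)"
    by (simp only: mat_pochhammer_Suc_left Suc.IH)
  also have "\<dots> = mat (-1) ** ?Y ** (mat ((-1) ^ r) ** ?p)"
  proof -
    have "X - mat (of_nat (Suc r)) = mat (-1) ** ?Y"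
      by (simp add: vec_eq_iff) (simp add: mat_def)
    then show ?thesis by (simp only:)
  qed
  also have "mat (-1) ** ?Y ** (mat ((-1) ^ r) ** ?p) = mat ((-1) ^ Suc r) ** (?Y ** ?p)"
    by (simp add: mat_left_commute[of _ ?Y] mat_mult_mat_left flip: matrix_mul_assoc)
  also have "?Y ** ?p = ?p ** ?Y"
    by (intro mcommuteD mcommute_pochhammer mcommute_add_mat_left mcommute_refl)
  finally show ?case by (simp only: mat_pochhammer_Suc[of "mat 1 - X"])
qed simp

section \<open>The three differential formulas\<close>

lemma pRq_eq_mseries: "pRq Cs Ds A B = mseries (pRq_coeff Cs Ds A B)"
  by (simp add: fun_eq_iff pRq_def mseries_def)

text \<open>Membership of z in the second disc is what allows the outer factors to be taken out of
  the sum.\<close>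

lemma deriv_pRq:
  fixes A B :: "complex^'n^'n" and r :: nat
  assumes adm: "admissible Ds"
    and "\<And>C C'. C \<in> set Cs \<Longrightarrow> C' \<in> set Cs \<Longrightarrow> mcommute C C'"
    and "\<And>C. C \<in> set Cs \<Longrightarrow> mcommute C A" "\<And>C. C \<in> set Cs \<Longrightarrow> mcommute C B"
    and "\<And>D D'. D \<in> set Ds \<Longrightarrow> D' \<in> set Ds \<Longrightarrow> mcommute D D'"
  defines "Cs' \<equiv> map (\<lambda>C. C + mat (of_nat r)) Cs"
    and "Ds' \<equiv> map (\<lambda>D. D + mat (of_nat r)) Ds"
    and "B' \<equiv> mat (of_nat r) ** A + B"
  assumes z: "z \<in> pRq_disc Cs Ds A B" "z \<in> pRq_disc Cs' Ds' A B'"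
  shows "(mat_deriv ^^ r) (pRq Cs Ds A B) z =
    mat_prod (map (\<lambda>C. mat_pochhammer C r) Cs) ** pRq Cs' Ds' A B' z **
    mat_prod (map (\<lambda>D. matrix_inv (mat_pochhammer D r)) Ds)"
proof -
  let ?L = "mat_prod (map (\<lambda>C. mat_pochhammer C r) Cs)"
    and ?R = "mat_prod (map (\<lambda>D. matrix_inv (mat_pochhammer D r)) Ds)"
  have sums: "summable (\<lambda>n. mat (z ^ n) ** pRq_coeff Cs' Ds' A B' n)"
    using z(2) by (intro mseries_convD[OF mseries_conv_le_conv_radius]) (simp add: pRq_disc_def)
  have "(mat_deriv ^^ r) (pRq Cs Ds A B) z =
      mseries (\<lambda>n. mat (fact (n + r) / fact n) ** pRq_coeff Cs Ds A B (n + r)) z"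
    unfolding pRq_eq_mseries
    using z(1) by (intro iterate_mat_deriv_mseries(2)[OF mseries_conv_le_conv_radius])
      (simp add: pRq_disc_def)
  also have "\<dots> = mseries (\<lambda>n. ?L ** pRq_coeff Cs' Ds' A B' n ** ?R) z"
    unfolding Cs'_def Ds'_def B'_def by (subst pRq_coeff_add[OF assms(1-5)]) simp_all
  also have "\<dots> = ?L ** pRq Cs' Ds' A B' z ** ?R"
    by (simp only: mseries_mult_right(2)[OF mseries_mult_left(1)[OF sums]]
        mseries_mult_left(2)[OF sums] pRq_eq_mseries)
  finally show ?thesis .
qed

lemma deriv_pRq_powm:
  assumes j: "j < length Ds" and comm: "\<And>D. D \<in> set Ds \<Longrightarrow> mcommute D (Ds ! j)"
    and adm: "admissible Ds" "admissible (Ds[j := Ds ! j - mat (of_nat r)])"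
    and z: "z \<in> pRq_disc Cs Ds A B - \<real>\<^sub>\<le>\<^sub>0"
  shows "(mat_deriv ^^ r) (\<lambda>z. pRq Cs Ds A B z ** z powm (Ds ! j - mat 1)) z =
    pRq Cs (Ds[j := Ds ! j - mat (of_nat r)]) A B z **
    mat ((-1) ^ r) ** z powm (Ds ! j - mat (of_nat (r + 1))) ** mat_pochhammer (mat 1 - Ds ! j) r"
proof -
  let ?a = "pRq_coeff Cs Ds A B" and ?a' = "pRq_coeff Cs (Ds[j := Ds ! j - mat (of_nat r)]) A B"
  let ?Q = "mat_pochhammer (Ds ! j - mat (of_nat r)) r" and ?M = "Ds ! j - mat 1"
    and ?N = "Ds ! j - mat (of_nat (r + 1))" and ?p = "mat_pochhammer (mat 1 - Ds ! j) r"
  let ?b = "\<lambda>n. ?a n ** mat_pochhammer (?M + mat (of_nat n - of_nat r + 1)) r"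
  have b: "?b = (\<lambda>n. ?a' n ** ?Q)"
  proof
    fix n
    \<comment> \<open>The -I in the exponent D_j-I cancels the +1 of the falling product.\<close>
    have "?M + mat (of_nat n - of_nat r + 1) = Ds ! j + mat (of_nat n - of_nat r)"
      by (simp add: diff_mat add.assoc mat_add_mat)
    then show "?b n = ?a' n ** ?Q"
      by (simp only: pRq_coeff_lower_denominator[OF j comm adm])
  qed
  have conv: "mseries_conv (conv_radius ?a) ?b"
    by (rule iterate_mat_deriv_mseries_powm(1)[OF mseries_conv_le_conv_radius])
  \<comment> \<open>The factors of \<open>?Q\<close> are D_j-rI, ..., D_j-I, invertible by
    admissibility of the lowered list. Cancelling \<open>?Q\<close> carries convergence from
    \<open>?b\<close> over to \<open>?a'\<close> on the original disc.\<close>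
  have "invertible ?Q"
    using j by (intro admissible_invertible_pochhammer[OF adm(2)] set_update_memI)
  then have "?b n ** matrix_inv ?Q = ?a' n" for n
    unfolding fun_cong[OF b, of n] by (simp add: matrix_inv_inverts flip: matrix_mul_assoc)
  then have conv': "mseries_conv (conv_radius ?a) ?a'"
    using mseries_conv_mult_right[OF conv, of "matrix_inv ?Q"] by simp
  have sums: "summable (\<lambda>n. mat (z ^ n) ** ?a' n)"
    using z by (intro mseries_convD[OF conv']) (simp add: pRq_disc_def)
  have N: "?M - mat (of_nat r) = ?N"
    by (simp add: diff_mat add.assoc mat_add_mat add.commute)
  \<comment> \<open>The termwise derivative leaves the Pochhammer factor to the left of the power,
    while the formula has it on the right. Writing I-D_j as a sum fits the closure rules.\<close>
  have "mcommute (Ds ! j) (- (Ds ! j) + mat 1)"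
    by (intro mcommute_add mcommute_uminus mcommute_refl mcommute_mat)
  then have "mcommute ?p (Ds ! j)"
    by (intro mcommute_sym[OF mcommute_pochhammer]) simp
  then have "mcommute ?p (z powm ?N)"
    unfolding diff_mat by (intro mcommute_powm mcommute_add) simp_all
  then have comm_p: "?p ** z powm ?N = z powm ?N ** ?p"
    by (rule mcommuteD)
  have "(mat_deriv ^^ r) (\<lambda>z. pRq Cs Ds A B z ** z powm ?M) z =
      mseries ?b z ** z powm (?M - mat (of_nat r))"
    unfolding pRq_eq_mseries using z
    by (intro iterate_mat_deriv_mseries_powm(3)[OF mseries_conv_le_conv_radius])
      (simp add: pRq_disc_def)
  also have "\<dots> = mseries ?a' z ** (mat ((-1) ^ r) ** ?p) ** z powm ?N"
    by (simp only: b mseries_mult_right(2)[OF sums] N mat_pochhammer_reflect)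
  also have "\<dots> = mseries ?a' z ** mat ((-1) ^ r) ** (?p ** z powm ?N)"
    by (simp only: matrix_mul_assoc)
  also have "\<dots> = mseries ?a' z ** mat ((-1) ^ r) ** z powm ?N ** ?p"
    by (simp only: comm_p matrix_mul_assoc)
  finally show ?thesis
    by (simp only: pRq_eq_mseries)
qed

text \<open>Every z^2 d/dz raises the exponent by one, so the power must start at C_i to end at
  C_i+rI with the factor (C_i+nI)_r. Starting at C_i-(r-1)I would end at C_i+I with the factor
  (C_i+(n-r+1)I)_r; the two starting exponents coincide for r = 1.\<close>

lemma z2_deriv_powm_pRq:
  fixes A B :: "complex^'n^'n" and r :: nat
  assumes i: "i < length Cs" and "\<And>C. C \<in> set Cs \<Longrightarrow> mcommute (Cs ! i) C"
    and "mcommute (Cs ! i) A" "mcommute (Cs ! i) B"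
  defines "Cs' \<equiv> Cs[i := Cs ! i + mat (of_nat r)]"
  assumes z: "z \<in> pRq_disc Cs Ds A B \<inter> pRq_disc Cs' Ds A B - \<real>\<^sub>\<le>\<^sub>0"
  shows "(z2_deriv ^^ r) (\<lambda>z. z powm (Cs ! i) ** pRq Cs Ds A B z) z =
    mat_pochhammer (Cs ! i) r ** z powm (Cs ! i + mat (of_nat r)) ** pRq Cs' Ds A B z"
proof -
  let ?p = "mat_pochhammer (Cs ! i) r" and ?P = "z powm (Cs ! i + mat (of_nat r))"
  have sums: "summable (\<lambda>n. mat (z ^ n) ** pRq_coeff Cs' Ds A B n)"
    using z by (intro mseries_convD[OF mseries_conv_le_conv_radius]) (simp add: pRq_disc_def)
  have "(z2_deriv ^^ r) (\<lambda>z. z powm (Cs ! i) ** pRq Cs Ds A B z) z =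
      ?P ** mseries (\<lambda>n. mat_pochhammer (Cs ! i + mat (of_nat n)) r ** pRq_coeff Cs Ds A B n) z"
    unfolding pRq_eq_mseries using z
    by (intro iterate_z2_deriv_powm_mseries(2)[OF mseries_conv_le_conv_radius])
      (simp add: pRq_disc_def)
  also have "(\<lambda>n. mat_pochhammer (Cs ! i + mat (of_nat n)) r ** pRq_coeff Cs Ds A B n) =
      (\<lambda>n. ?p ** pRq_coeff Cs' Ds A B n)"
    unfolding Cs'_def by (intro ext pRq_coeff_raise_numerator assms(1-4))
  also have "?P ** mseries (\<lambda>n. ?p ** pRq_coeff Cs' Ds A B n) z = ?P ** ?p ** pRq Cs' Ds A B z"
    by (simp only: mseries_mult_left(2)[OF sums] pRq_eq_mseries matrix_mul_assoc)
  also have "?P ** ?p = ?p ** ?P"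
    by (rule mcommuteD[OF mcommute_pochhammer[OF mcommute_sym[OF mcommute_powm]]])
      (simp add: mcommute_add)
  finally show ?thesis .
qed

theorem theorem4p1:
  fixes A B :: "complex^'n^'n" and Cs Ds :: "(complex^'n^'n) list" and r :: nat
  assumes "admissible Ds" and "r \<ge> 1"
  shows
   "((\<forall>C\<in>set Cs. (\<forall>C'\<in>set Cs. C ** C' = C' ** C) \<and> C ** A = A ** C \<and> C ** B = B ** C) \<and>
     (\<forall>D\<in>set Ds. \<forall>D'\<in>set Ds. D ** D' = D' ** D) \<longrightarrow>
     (let Cs' = map (\<lambda>C. C + mat (of_nat r)) Cs;
          Ds' = map (\<lambda>D. D + mat (of_nat r)) Ds;
          B' = mat (of_nat r) ** A + B;
          S = pRq_disc Cs Ds A B \<inter> pRq_disc Cs' Ds' A B'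
      in mat_holomorphic_on (pRq Cs Ds A B) S \<and>
         (\<forall>z\<in>S. (mat_deriv ^^ r) (pRq Cs Ds A B) z =
            mat_prod (map (\<lambda>C. mat_pochhammer C r) Cs) **
            pRq Cs' Ds' A B' z **
            mat_prod (map (\<lambda>D. matrix_inv (mat_pochhammer D r)) Ds))))
    \<and>
    (\<forall>j<length Ds.
     (\<forall>D\<in>set Ds. D ** Ds ! j = Ds ! j ** D) \<and> admissible (Ds[j := Ds ! j - mat (of_nat r)]) \<longrightarrow>
     (let F = (\<lambda>z. pRq Cs Ds A B z ** z powm (Ds ! j - mat 1));
          S = pRq_disc Cs Ds A B - \<real>\<^sub>\<le>\<^sub>0
      in mat_holomorphic_on F S \<and>
         (\<forall>z\<in>S. (mat_deriv ^^ r) F z =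
            pRq Cs (Ds[j := Ds ! j - mat (of_nat r)]) A B z **
            mat ((-1) ^ r) ** z powm (Ds ! j - mat (of_nat (r + 1))) **
            mat_pochhammer (mat 1 - Ds ! j) r)))
    \<and>
    ((\<forall>C\<in>set Cs. (\<forall>C'\<in>set Cs. C ** C' = C' ** C) \<and> C ** A = A ** C \<and> C ** B = B ** C) \<longrightarrow>
     (\<forall>i<length Cs.
       let Cs' = Cs[i := Cs ! i + mat (of_nat r)];
           F = (\<lambda>z. z powm (Cs ! i) ** pRq Cs Ds A B z);
           S = pRq_disc Cs Ds A B \<inter> pRq_disc Cs' Ds A B - \<real>\<^sub>\<le>\<^sub>0
       in mat_holomorphic_on F S \<and>
          (\<forall>z\<in>S. (z2_deriv ^^ r) F z =
             mat_pochhammer (Cs ! i) r **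
             z powm (Cs ! i + mat (of_nat r)) **
             pRq Cs' Ds A B z)))"
proof (intro conjI allI impI)
  assume comm: "(\<forall>C\<in>set Cs. (\<forall>C'\<in>set Cs. C ** C' = C' ** C) \<and> C ** A = A ** C \<and> C ** B = B ** C) \<and>
    (\<forall>D\<in>set Ds. \<forall>D'\<in>set Ds. D ** D' = D' ** D)"
  show "let Cs' = map (\<lambda>C. C + mat (of_nat r)) Cs;
      Ds' = map (\<lambda>D. D + mat (of_nat r)) Ds;
      B' = mat (of_nat r) ** A + B;
      S = pRq_disc Cs Ds A B \<inter> pRq_disc Cs' Ds' A B'
    in mat_holomorphic_on (pRq Cs Ds A B) S \<and>
      (\<forall>z\<in>S. (mat_deriv ^^ r) (pRq Cs Ds A B) z =
        mat_prod (map (\<lambda>C. mat_pochhammer C r) Cs) ** pRq Cs' Ds' A B' z **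
        mat_prod (map (\<lambda>D. matrix_inv (mat_pochhammer D r)) Ds))"
    unfolding Let_def
  proof (intro conjI ballI deriv_pRq assms(1))
    show "mat_holomorphic_on (pRq Cs Ds A B) (pRq_disc Cs Ds A B \<inter> S)" for S
      using iterate_mat_deriv_mseries(1)[OF mseries_conv_le_conv_radius]
      unfolding pRq_eq_mseries pRq_disc_def mat_holomorphic_on_def
      by (blast intro: holomorphic_on_subset)
  qed (use comm in \<open>auto simp: mcommute_def\<close>)
next
  fix j
  assume j: "j < length Ds"
    and ass: "(\<forall>D\<in>set Ds. D ** Ds ! j = Ds ! j ** D) \<and> admissible (Ds[j := Ds ! j - mat (of_nat r)])"
  have comm: "mcommute D (Ds ! j)" if "D \<in> set Ds" for D
    using ass that by (simp add: mcommute_def)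
  show "let F = \<lambda>z. pRq Cs Ds A B z ** z powm (Ds ! j - mat 1);
      S = pRq_disc Cs Ds A B - \<real>\<^sub>\<le>\<^sub>0
    in mat_holomorphic_on F S \<and>
      (\<forall>z\<in>S. (mat_deriv ^^ r) F z =
        pRq Cs (Ds[j := Ds ! j - mat (of_nat r)]) A B z **
        mat ((-1) ^ r) ** z powm (Ds ! j - mat (of_nat (r + 1))) **
        mat_pochhammer (mat 1 - Ds ! j) r)"
    unfolding Let_def
  proof (intro conjI ballI deriv_pRq_powm[OF j comm assms(1)])
    show "mat_holomorphic_on (\<lambda>z. pRq Cs Ds A B z ** z powm (Ds ! j - mat 1))
        (pRq_disc Cs Ds A B - \<real>\<^sub>\<le>\<^sub>0)"
      unfolding pRq_eq_mseries pRq_disc_def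
      by (rule iterate_mat_deriv_mseries_powm(2)[OF mseries_conv_le_conv_radius])
    show "admissible (Ds[j := Ds ! j - mat (of_nat r)])"
      using ass by blast
  qed
next
  fix i
  assume comm: "\<forall>C\<in>set Cs. (\<forall>C'\<in>set Cs. C ** C' = C' ** C) \<and> C ** A = A ** C \<and> C ** B = B ** C"
    and i: "i < length Cs"
  show "let Cs' = Cs[i := Cs ! i + mat (of_nat r)];
      F = \<lambda>z. z powm (Cs ! i) ** pRq Cs Ds A B z;
      S = pRq_disc Cs Ds A B \<inter> pRq_disc Cs' Ds A B - \<real>\<^sub>\<le>\<^sub>0
    in mat_holomorphic_on F S \<and>
      (\<forall>z\<in>S. (z2_deriv ^^ r) F z =
        mat_pochhammer (Cs ! i) r ** z powm (Cs ! i + mat (of_nat r)) ** pRq Cs' Ds A B z)"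
    unfolding Let_def
  proof (intro conjI ballI z2_deriv_powm_pRq[OF i])
    show "mat_holomorphic_on (\<lambda>z. z powm (Cs ! i) ** pRq Cs Ds A B z)
        (pRq_disc Cs Ds A B \<inter> S - \<real>\<^sub>\<le>\<^sub>0)" for S
      using iterate_z2_deriv_powm_mseries(1)[OF mseries_conv_le_conv_radius]
      unfolding pRq_eq_mseries pRq_disc_def mat_holomorphic_on_def
      by (blast intro: holomorphic_on_subset)
  qed (use comm i in \<open>simp_all add: mcommute_def\<close>)
qed

end
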